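(* Let $n\ge 1$, let $\lambda/\mu$ be a skew shape with $m=|\lambda/\mu|$, and let $\alpha=(\alpha_1,\dots,\alpha_n)$ be a weak composition of $m$ with $n$ parts. Suppose $\gcd(m,n)=1$. Let $X$ be the (disjoint) union $$X=\bigcup_{r=1}^n \mathrm{SSYT}(\lambda/\mu,\mathrm{cyc}_r(\alpha)).$$ Then the triple $$\Bigl(X,\ \langle c_n\rangle,\ \sum_{T\in X} q^{\,w_1(T)+2w_2(T)+\dotsb+n\,w_n(T)}\Bigr)$$ exhibits the cyclic sieving phenomenon.
   Context: Cyclic sieving: given a finite set $X$, a cyclic group $C$ of order $n$ acting on $X$, and a polynomial $f(q)$, the triple $(X,C,f(q))$ exhibits the cyclic sieving phenomenon if for all $k\in\mathbb{Z}$, $|\{x\in X: g^k\cdot x=x\}|=f(\xi^k)$, where $g$ is a generator of $C$ and $\xi$ is a primitive $n$th root of unity. A weak composition of $m$ with $n$ parts is a vector $(\alpha_1,\dots,\alpha_n)$ of nonnegative integers with sum $m$. The cyclic shift is $\mathrm{cyc}_r(\alpha)=(\alpha_{1+r},\alpha_{2+r},\dots,\alpha_{n+r})$, indices taken modulo $n$. For a skew shape $\lambda/\mu$, $|\lambda/\mu|=|\lambda|-|\mu|$ is its number of boxes. $\mathrm{SSYT}(\lambda/\mu,n)$ is the set of semistandard Young tableaux of shape $\lambda/\mu$ (English notation, rows weakly increasing, columns strictly increasing) with entries in $\{1,\dots,n\}$; $w_i(T)$ is the number of entries of $T$ equal to $i$; and $\mathrm{SSYT}(\lambda/\mu,\alpha)$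 is the subset of those $T$ with $w_i(T)=\alpha_i$ for all $i$. Crystal reflection operators: for $1\le i\le n-1$, $\tilde s_i$ acts on $T\in\mathrm{SSYT}(\lambda/\mu,n)$ as follows. Read the entries of $T$ row by row, from the bottom row to the top row, each row left to right. Replace each $i+1$ by "(" and each $i$ by ")" and match parentheses in the usual way. The unmatched letters form a subword $i^a(i+1)^b$; change these entries, in their positions, to $i^b(i+1)^a$, leaving all other entries unchanged. The result $\tilde s_i(T)$ is again in $\mathrm{SSYT}(\lambda/\mu,n)$, and $\tilde s_1,\dots,\tilde s_{n-1}$ define an action of the symmetric group $S_n$ on $\mathrm{SSYT}(\lambda/\mu,n)$ with $\tilde s_i$ the action of the simple transposition $(i\ i+1)$. Set $c_n=\tilde s_1\tilde s_2\cdots\tilde s_{n-1}$ (with $\tilde s_1$ applied first), the action of an $n$-cycle; it gives bijections $\mathrm{SSYT}(\lambda/\mu,\alpha)\to\mathrm{SSYT}(\lambda/\mu,\mathrm{cyc}_1(\alpha))$. Here $\langle c_n\rangle$ denotes the cyclic subgroup of order $n$ of $S_n$ generated by this $n$-cycle, acting on tableaux in this way. *)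

theory Defs
  imports
    Complex_Main
    "HOL-Library.Disjoint_Sets"
    "HOL-Algebra.Elementary_Groups"
    "HOL-Algebra.Group_Action"
    "HOL-Algebra.Sym_Groups"
    "HOL-Computational_Algebra.Polynomial"
begin

definition primitive_root_of_unity :: "nat \<Rightarrow> complex \<Rightarrow> bool" where
  "primitive_root_of_unity n \<xi> \<longleftrightarrow> \<xi> ^ n = 1 \<and> (\<forall>k\<in>{1..<n}. \<xi> ^ k \<noteq> 1)"

text \<open>
  The generator and the primitive root are universally quantified; the condition does not
  depend on the choice of either, because \<open>g ^ j\<close> and \<open>g\<close> have the same fixed points
  whenever \<open>j\<close> is coprime to the order of the group.
\<close>
definition exhibits_CSP ::
    "'x set \<Rightarrow> ('g, 'm) monoid_scheme \<Rightarrow> ('g \<Rightarrow> 'x \<Rightarrow> 'x) \<Rightarrow> complex poly \<Rightarrow> bool" where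
  "exhibits_CSP X C \<phi> f \<longleftrightarrow>
     finite X \<and> cyclic_group C \<and> finite (carrier C) \<and> group_action C X \<phi> \<and>
     (\<forall>g \<xi>. g \<in> carrier C \<longrightarrow> generate C {g} = carrier C \<longrightarrow>
        primitive_root_of_unity (card (carrier C)) \<xi> \<longrightarrow>
        (\<forall>k::int. of_nat (card {x \<in> X. \<phi> (g [^]\<^bsub>C\<^esub> k) x = x}) = poly f (\<xi> powi k)))"

definition is_partition :: "nat list \<Rightarrow> bool" where
  "is_partition lam \<longleftrightarrow> sorted_wrt (\<ge>) lam \<and> 0 \<notin> set lam"

definition part :: "nat list \<Rightarrow> nat \<Rightarrow> nat" where
  "part lam i = (if i < length lam then lam ! i else 0)"

definition skew_shape :: "nat list \<Rightarrow> nat list \<Rightarrow> bool" where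
  "skew_shape lam mu \<longleftrightarrow>
     is_partition lam \<and> is_partition mu \<and> (\<forall>i. part mu i \<le> part lam i)"

definition skew_size :: "nat list \<Rightarrow> nat list \<Rightarrow> nat" where
  "skew_size lam mu = sum_list lam - sum_list mu"

text \<open>Boxes are pairs (row, column), both counted from 0, with row 0 the top row.\<close>
definition boxes :: "nat list \<Rightarrow> nat list \<Rightarrow> (nat \<times> nat) set" where
  "boxes lam mu = {(i, j). part mu i \<le> j \<and> j < part lam i}"

type_synonym tableau = "nat \<times> nat \<Rightarrow> nat"

definition SSYT :: "nat list \<Rightarrow> nat list \<Rightarrow> nat \<Rightarrow> tableau set" where
  "SSYT lam mu n = {T \<in> boxes lam mu \<rightarrow>\<^sub>E {1..n}.
     (\<forall>i j j'. (i, j) \<in> boxes lam mu \<longrightarrow> (i, j') \<in> boxes lam mu \<longrightarrow> j < j' \<longrightarrow> T (i, j) \<le> T (i, j')) \<and>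
     (\<forall>i i' j. (i, j) \<in> boxes lam mu \<longrightarrow> (i', j) \<in> boxes lam mu \<longrightarrow> i < i' \<longrightarrow> T (i, j) < T (i', j))}"

definition weight :: "nat list \<Rightarrow> nat list \<Rightarrow> tableau \<Rightarrow> nat \<Rightarrow> nat" where
  "weight lam mu T i = card {c \<in> boxes lam mu. T c = i}"

definition weak_composition :: "nat list \<Rightarrow> nat \<Rightarrow> nat \<Rightarrow> bool" where
  "weak_composition \<alpha> m n \<longleftrightarrow> length \<alpha> = n \<and> sum_list \<alpha> = m"

text \<open>
  The list \<open>\<alpha>\<close> is \<open>[\<alpha>\<^sub>1, \<dots>, \<alpha>\<^sub>n]\<close>.  The cyclic shift
  \<open>(\<alpha>\<^sub>1\<^sub>+\<^sub>r, \<dots>, \<alpha>\<^sub>n\<^sub>+\<^sub>r)\<close> (indices modulo \<open>n\<close>) is \<open>rotate r \<alpha>\<close>.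
\<close>
definition SSYT_content :: "nat list \<Rightarrow> nat list \<Rightarrow> nat list \<Rightarrow> tableau set" where
  "SSYT_content lam mu \<alpha> =
     {T \<in> SSYT lam mu (length \<alpha>). \<forall>i\<in>{1..length \<alpha>}. weight lam mu T i = \<alpha> ! (i - 1)}"

definition reading_order :: "nat list \<Rightarrow> nat list \<Rightarrow> (nat \<times> nat) list" where
  "reading_order lam mu =
     concat (map (\<lambda>i. map (Pair i) [part mu i..<part lam i]) (rev [0..<length lam]))"

text \<open>
  Left-to-right bracket matching of a list of positions labelled by \<open>T\<close>, where
  \<open>i + 1\<close> is an opening and \<open>i\<close> a closing bracket.  The first accumulator is the stack of
  currently unmatched opening positions, the second one collects the closing positions that
  found the stack empty.  The result is the pair (unmatched closing positions, unmatched
  opening positions), both from left to right; all of the former precede all of the latter.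
\<close>
primrec unmatched_aux ::
    "('a \<Rightarrow> nat) \<Rightarrow> nat \<Rightarrow> 'a list \<Rightarrow> 'a list \<Rightarrow> 'a list \<Rightarrow> 'a list \<times> 'a list" where
  "unmatched_aux T i [] opening closing = (rev closing, rev opening)"
| "unmatched_aux T i (c # cs) opening closing =
     (if T c = Suc i then unmatched_aux T i cs (c # opening) closing
      else if T c = i then
        (case opening of
           [] \<Rightarrow> unmatched_aux T i cs [] (c # closing)
         | _ # opening' \<Rightarrow> unmatched_aux T i cs opening' closing)
      else unmatched_aux T i cs opening closing)"

definition unmatched :: "('a \<Rightarrow> nat) \<Rightarrow> nat \<Rightarrow> 'a list \<Rightarrow> 'a list \<times> 'a list" where
  "unmatched T i cs = unmatched_aux T i cs [] []"

text \<open>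
  The unmatched subword \<open>i\<^sup>a (i+1)\<^sup>b\<close> becomes \<open>i\<^sup>b (i+1)\<^sup>a\<close>, where \<open>a\<close> and \<open>b\<close> are the
  numbers of unmatched closing and opening brackets.
\<close>
definition crystal_reflection :: "nat list \<Rightarrow> nat list \<Rightarrow> nat \<Rightarrow> tableau \<Rightarrow> tableau" where
  "crystal_reflection lam mu i T =
     (let (closing, opening) = unmatched T i (reading_order lam mu);
          us = closing @ opening;
          b = length opening
      in (\<lambda>c. if c \<in> set (take b us) then i
              else if c \<in> set (drop b us) then Suc i
              else T c))"

text \<open>Note that \<^const>\<open>fold\<close> applies the operator with index 1 first.\<close>
definition crystal_cycle :: "nat list \<Rightarrow> nat list \<Rightarrow> nat \<Rightarrow> tableau \<Rightarrow> tableau" where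
  "crystal_cycle lam mu n = fold (crystal_reflection lam mu) [1..<n]"

text \<open>This is the cycle \<open>1 \<mapsto> n\<close>, \<open>i \<mapsto> i - 1\<close> for \<open>1 < i \<le> n\<close>, written
  as a product of simple transpositions in the same order.\<close>
definition n_cycle :: "nat \<Rightarrow> nat \<Rightarrow> nat" where
  "n_cycle n = fold (\<lambda>i p. transpose i (Suc i) \<circ> p) [1..<n] id"

definition cycle_group :: "nat \<Rightarrow> (nat \<Rightarrow> nat) monoid" where
  "cycle_group n = subgroup_generated (sym_group n) {n_cycle n}"

text \<open>
  The map by which \<open>cycle_group n\<close> acts on a set \<open>X\<close> of tableaux: the \<open>k\<close>-th power of the
  cycle acts as the \<open>k\<close>-th power of \<open>crystal_cycle\<close>.  The least such \<open>k\<close> is taken merely to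
  have a value; that this is a group action is part of \<^const>\<open>exhibits_CSP\<close>.  The restriction
  to \<open>X\<close> is needed because the library's \<^const>\<open>group_action\<close> uses extensional bijections.
\<close>
definition cycle_action ::
    "nat list \<Rightarrow> nat list \<Rightarrow> nat \<Rightarrow> tableau set \<Rightarrow> (nat \<Rightarrow> nat) \<Rightarrow> tableau \<Rightarrow> tableau" where
  "cycle_action lam mu n X \<sigma> =
     restrict (crystal_cycle lam mu n ^^ (LEAST k. n_cycle n ^^ k = \<sigma>)) X"

end

theory Submission
  imports "HOL-Algebra.Multiplicative_Group" Defs
begin

text \<open>
Write \<open>c\<close> for the crystal cycle and \<open>s(T)\<close> for the exponent
  \<open>w\<^sub>1(T) + 2 w\<^sub>2(T) + \<dots> + n w\<^sub>n(T)\<close>.  As \<open>c\<close> rotates the content by one step, it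
  lowers every index by one, except that index \<open>1\<close> becomes \<open>n\<close>; hence
  \<open>s(c T) + m \<equiv> s(T)\<close> modulo \<open>n\<close> (\<open>sum_shift_weight\<close>).  Everything that concerns
  fixed points follows from this congruence.  If \<open>c\<^sup>k T\<close> has the same exponent as \<open>T\<close>, then
  \<open>n\<close> divides \<open>k m\<close>, hence \<open>k\<close> (\<open>dvd_return_time\<close>).  So the \<open>n\<close> rotations of \<open>\<alpha>\<close> give disjoint
  sets of tableaux, and \<open>c\<^sup>k\<close> has no fixed point unless \<open>n\<close> divides \<open>k\<close>.  If \<open>\<zeta>\<^sup>n = 1\<close> and
  \<open>\<zeta> \<noteq> 1\<close>, then reindexing the sum \<open>f(\<zeta>) = \<Sum>\<^sub>T \<zeta>\<^sup>s\<^sup>(\<^sup>T\<^sup>)\<close> along \<open>c\<close> gives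
  \<open>\<zeta>\<^sup>m f(\<zeta>) = f(\<zeta>)\<close>, and \<open>\<zeta>\<^sup>m \<noteq> 1\<close>, so \<open>f(\<zeta>) = 0\<close>.

  What remains is that the cyclic group of order \<open>n\<close> acts at all, that is, \<open>c\<^sup>n = id\<close>
  (\<open>crystal_cycle_funpow_n\<close>).  This is usually read off from the braid relations for the
  reflection operators.  Here it is proved directly, for words instead of tableaux, by a
  connectedness argument.

  \<^item> A reflection of a word can be computed by matching brackets cyclically, because the
    brackets that linear matching leaves over and the reflection keeps are exactly those that
    become matched around the end of the word.  So reflections commute with rotation of words
    (\<open>reflect_rotate1\<close>).
  \<^item> If two words differ by a Knuth relation at a given place, then so do their reflections,
    at the same place (\<open>knuth_swap_reflect\<close>).
  \<^item> Rotations and Knuth relations connect every word with a weakly increasing one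
    (\<open>knuth_rotate_induct\<close>): keep a weakly increasing prefix and insert the letter that follows
    it by Schensted row insertion; either the prefix grows, or a letter is bumped out, which
    rotation carries to the other end, and the sum of the prefix drops.
  \<^item> On a weakly increasing word a reflection exchanges two multiplicities, so \<open>c\<close> rotates the
    multiplicities of the letters \<open>1, \<dots>, n\<close>, and \<open>c\<^sup>n\<close> is the identity.  The previous points
    carry this over to all words (\<open>word_cycle_funpow_n\<close>).

  The reading word determines a filling of the boxes, and the operators on fillings are those on
  reading words (\<open>map_crystal_reflection\<close>); so \<open>c\<^sup>n = id\<close> holds for arbitrary fillings.
  Semistandardness enters only in showing that \<open>c\<close> maps the given set of tableaux to itself
  (\<open>crystal_reflection_SSYT\<close>).
\<close>

section \<open>Reflections of words by cyclic bracket matching\<close>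

text \<open>
  Reading a word from left to right, the state is the number of opening brackets \<open>i +
  1\<close> that are still waiting for a closing bracket \<open>i\<close>.  Truncated subtraction
  is intended: a closing bracket that finds nothing waiting leaves the state at \<open>0\<close>.
\<close>
definition push_state :: "nat \<Rightarrow> nat \<Rightarrow> nat \<Rightarrow> nat" where
  "push_state i x r = (if x = Suc i then Suc r else if x = i then r - 1 else r)"

abbreviation raise_state :: "nat \<Rightarrow> nat list \<Rightarrow> nat \<Rightarrow> nat" where
  "raise_state i \<equiv> fold (push_state i)"

text \<open>
  The initial state \<open>r\<close> stands for opening brackets that wait before the word begins.
  If the scan also ends in state \<open>r\<close>, then these are the openings left over at the
  end of the word, wrapped around to its beginning; the scan then matches brackets cyclically and
  turns precisely the cyclically unmatched \<open>i\<close> into \<open>i + 1\<close>.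
\<close>
primrec raise :: "nat \<Rightarrow> nat list \<Rightarrow> nat \<Rightarrow> nat list" where
  "raise i [] r = []"
| "raise i (x # w) r =
     (if x = i \<and> r = 0 then Suc i else x) # raise i w (push_state i x r)"

text \<open>
  The mirror image of \<^const>\<open>push_state\<close>, for scanning from right to left: now
  closing brackets wait for opening ones.
\<close>
definition pull_state :: "nat \<Rightarrow> nat \<Rightarrow> nat \<Rightarrow> nat" where
  "pull_state i x r = (if x = i then Suc r else if x = Suc i then r - 1 else r)"

abbreviation lower_state :: "nat \<Rightarrow> nat list \<Rightarrow> nat \<Rightarrow> nat" where
  "lower_state i \<equiv> foldr (pull_state i)"

primrec lower :: "nat \<Rightarrow> nat list \<Rightarrow> nat \<Rightarrow> nat list" where
  "lower i [] r = []"
| "lower i (x # w) r =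
     (if x = Suc i \<and> lower_state i w r = 0 then i else x) # lower i w r"

text \<open>
  Reversing the word and exchanging the two kinds of brackets turns right-to-left scans into
  left-to-right ones, so that facts about \<^const>\<open>raise\<close> carry over to
  \<^const>\<open>lower\<close>.
\<close>
definition mirror :: "nat \<Rightarrow> nat list \<Rightarrow> nat list" where
  "mirror i w = map (transpose i (Suc i)) (rev w)"

text \<open>
  If there are at least as many \<open>i\<close> as \<open>i + 1\<close>, then cyclic matching
  leaves only closing brackets over, and these are raised; otherwise it leaves only opening
  brackets over, and these are lowered.  Starting the scan from \<open>0\<close> yields the number
  of linearly unmatched openings (respectively closings), which is the right initial state
  (\<open>raise_state_fixed\<close> below).  By \<open>reflect_eq_raise\<close> and
  \<open>reflect_eq_lower\<close> any other initial state that the scan reproduces gives the same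
  result; this freedom is what makes invariance under rotation evident.
\<close>
definition reflect :: "nat \<Rightarrow> nat list \<Rightarrow> nat list" where
  "reflect i w =
     (if count_list w (Suc i) \<le> count_list w i then raise i w (raise_state i w 0)
      else lower i w (lower_state i w 0))"

lemma length_raise [simp]: "length (raise i w r) = length w"
  by (induction w arbitrary: r) auto

lemma length_lower [simp]: "length (lower i w r) = length w"
  by (induction w) auto

lemma length_reflect [simp]: "length (reflect i w) = length w"
  by (simp add: reflect_def)

lemma raise_append: "raise i (u @ v) r = raise i u r @ raise i v (raise_state i u r)"
  by (induction u arbitrary: r) auto

lemma lower_append: "lower i (u @ v) r = lower i u (lower_state i v r) @ lower i v r"
  by (induction u) auto

lemma lower_state_mirror: "lower_state i w r = raise_state i (mirror i w) r"
proof -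
  have "pull_state i x = push_state i (transpose i (Suc i) x)" for x
    by (auto simp: fun_eq_iff push_state_def pull_state_def transpose_def)
  then show ?thesis
    by (induction w) (auto simp: mirror_def)
qed

lemma lower_mirror: "lower i w r = mirror i (raise i (mirror i w) r)"
proof (induction w)
  case (Cons x w)
  have "mirror i (x # w) = mirror i w @ [transpose i (Suc i) x]"
    by (simp add: mirror_def)
  then show ?case using Cons
    by (auto simp: raise_append lower_state_mirror mirror_def transpose_def)
qed (simp add: mirror_def)

lemma count_list_mirror: "count_list (mirror i w) j = count_list w (transpose i (Suc i) j)"
  by (induction w) (auto simp: mirror_def transpose_def)

lemma mirror_mirror [simp]: "mirror i (mirror i w) = w"
  unfolding mirror_def rev_map map_map by (simp add: comp_def rev_map)


text \<open>
  Every opening bracket adds one to the state, and every closing bracket that stays closing takes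
  one away.
\<close>
lemma raise_state_balance:
  "raise_state i w r + count_list (raise i w r) i = r + count_list w (Suc i)"
proof (induction w arbitrary: r)
  case (Cons x w)
  show ?case using Cons[of "push_state i x r"]
    by (cases "x = i"; cases "x = Suc i"; cases r) (simp_all add: push_state_def)
qed simp

lemma count_list_raise_other:
  "j \<noteq> i \<Longrightarrow> j \<noteq> Suc i \<Longrightarrow> count_list (raise i w r) j = count_list w j"
  by (induction w arbitrary: r) auto

lemma count_list_raise_sum:
  "count_list (raise i w r) i + count_list (raise i w r) (Suc i)
     = count_list w i + count_list w (Suc i)"
proof (induction w arbitrary: r)
  case (Cons x w)
  show ?case using Cons[of "push_state i x r"]
    by (cases "x = i"; cases "x = Suc i"; cases r) simp_all
qed simp

lemma count_list_raise_le: "count_list (raise i w r) i \<le> count_list w i"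
proof (induction w arbitrary: r)
  case (Cons x w)
  show ?case using Cons[of "push_state i x r"]
    by (cases "x = i"; cases r) simp_all
qed simp

lemma raise_eq_self_if_count:
  "count_list (raise i w r) i = count_list w i \<Longrightarrow> raise i w r = w"
proof (induction w arbitrary: r)
  case (Cons x w)
  have "\<not> (x = i \<and> r = 0)"
  proof
    assume "x = i \<and> r = 0"
    then have "count_list (raise i w 0) i = Suc (count_list w i)"
      using Cons.prems by (simp add: push_state_def)
    then show False
      using count_list_raise_le[of i w 0] by simp
  qed
  then show ?case
    using Cons by (auto split: if_splits)
qed simp

lemma raise_state_mono: "r \<le> r' \<Longrightarrow> raise_state i w r \<le> raise_state i w r'"
  by (induction w arbitrary: r r') (auto simp: push_state_def)

lemma raise_state_gap:
  "r \<le> r' \<Longrightarrow> raise_state i w r' - raise_state i w r \<le> r' - r"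
proof (induction w arbitrary: r r')
  case (Cons x w)
  have "push_state i x r \<le> push_state i x r'" "push_state i x r' - push_state i x r \<le> r' - r"
    using Cons.prems by (auto simp: push_state_def)
  then show ?case using Cons.IH[of "push_state i x r" "push_state i x r'"] by simp
qed simp

text \<open>
  Two scans of the same word approach each other exactly when one of them finds a bracket to match
  and the other does not.  If their distance is the same at the end as at the beginning, this
  never happened, and they made the same changes.
\<close>
lemma raise_eq_if_same_gap:
  "r \<le> r' \<Longrightarrow> raise_state i w r' - raise_state i w r = r' - r \<Longrightarrow> raise i w r = raise i w r'"
proof (induction w arbitrary: r r')
  case (Cons x w)
  let ?s = "push_state i x r" and ?s' = "push_state i x r'"
  have le: "?s \<le> ?s'" and gap: "?s' - ?s \<le> r' - r"
    using Cons.prems(1) by (auto simp: push_state_def)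
  have "?s' - ?s = r' - r"
    using raise_state_gap[OF le, of i w] gap Cons.prems(2) by simp
  moreover from this have "raise i w ?s = raise i w ?s'"
    using Cons.IH[OF le] Cons.prems(2) by simp
  ultimately show ?case
    using Cons.prems(1) by (auto simp: push_state_def split: if_splits)
qed simp

text \<open>
  When a scan changes a letter, its state is \<open>0\<close>.  A scan from a smaller state is in
  state \<open>0\<close> at that moment as well, and from there on both coincide.
\<close>
lemma raise_state_merge:
  "raise i w r \<noteq> w \<Longrightarrow> r' \<le> r \<Longrightarrow> raise_state i w r' = raise_state i w r"
proof (induction w arbitrary: r r')
  case (Cons x w)
  show ?case
  proof (cases "x = i \<and> r = 0")
    case True
    then show ?thesis using Cons.prems by simp
  next
    case False
    then have "raise i w (push_state i x r) \<noteq> w" using Cons.prems by auto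
    moreover have "push_state i x r' \<le> push_state i x r"
      using Cons.prems(2) by (auto simp: push_state_def)
    ultimately have "raise_state i w (push_state i x r') = raise_state i w (push_state i x r)"
      by (rule Cons.IH)
    then show ?thesis by simp
  qed
qed simp

text \<open>
  Let \<open>b\<close> be the final state from \<open>0\<close>.  If the scan from
  \<open>b\<close> changes a letter, it merges with the scan from \<open>0\<close> and ends in
  \<open>b\<close>.  If it changes none, its state does not increase in total, as there are not
  more openings than closings, while monotonicity keeps it at least \<open>b\<close>.
\<close>
lemma raise_state_fixed:
  assumes "count_list w (Suc i) \<le> count_list w i"
  shows "raise_state i w (raise_state i w 0) = raise_state i w 0"
proof (cases "raise i w (raise_state i w 0) = w")
  case True
  then have "raise_state i w (raise_state i w 0) \<le> raise_state i w 0"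
    using raise_state_balance[of i w "raise_state i w 0"] assms by simp
  then show ?thesis
    using raise_state_mono[of 0 "raise_state i w 0" i w] by simp
next
  case False
  then show ?thesis using raise_state_merge[of i w "raise_state i w 0" 0] by simp
qed

lemma raise_fixed_unique:
  assumes "raise_state i w r = r" "raise_state i w r' = r'"
  shows "raise i w r = raise i w r'"
proof (cases r r' rule: le_cases)
  case le
  then show ?thesis using raise_eq_if_same_gap[of r r' i w] assms by simp
next
  case ge
  then show ?thesis using raise_eq_if_same_gap[of r' r i w] assms by simp
qed

lemma raise_fixed_count:
  assumes "raise_state i w r = r"
  shows "count_list (raise i w r) i = count_list w (Suc i)"
    and "count_list w (Suc i) \<le> count_list w i"
  using raise_state_balance[of i w r] count_list_raise_le[of i w r] assms by auto

lemma reflect_eq_raise: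
  assumes "raise_state i w r = r"
  shows "reflect i w = raise i w r"
proof -
  have "count_list w (Suc i) \<le> count_list w i"
    using raise_fixed_count[OF assms] by simp
  then show ?thesis
    using raise_fixed_unique[OF assms raise_state_fixed] by (simp add: reflect_def)
qed

text \<open>
  A state reproduced from right to left excludes a surplus of \<open>i\<close>.  If the two
  letters are equally frequent, the definition of \<^const>\<open>reflect\<close> takes the other
  branch, but then both scans leave the word unchanged.
\<close>
lemma reflect_eq_lower:
  assumes "lower_state i w r = r"
  shows "reflect i w = lower i w r"
proof -
  have fixed: "raise_state i (mirror i w) r = r"
    using assms by (simp add: lower_state_mirror)
  have le: "count_list w i \<le> count_list w (Suc i)"
    using raise_fixed_count(2)[OF fixed] by (simp add: count_list_mirror)
  show ?thesis
  proof (cases "count_list w (Suc i) \<le> count_list w i")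
    case False
    then have "raise_state i (mirror i w) (raise_state i (mirror i w) 0) = raise_state i (mirror i w) 0"
      by (intro raise_state_fixed) (simp add: count_list_mirror)
    then show ?thesis
      using False raise_fixed_unique[OF fixed] by (simp add: reflect_def lower_mirror lower_state_mirror)
  next
    case True
    have "raise i (mirror i w) r = mirror i w"
      using raise_fixed_count(1)[OF fixed] le True
      by (intro raise_eq_self_if_count) (simp add: count_list_mirror)
    moreover have "raise i w (raise_state i w 0) = w"
      using raise_fixed_count(1)[OF raise_state_fixed[OF True]] le True
      by (intro raise_eq_self_if_count) simp
    ultimately show ?thesis using True by (simp add: reflect_def lower_mirror)
  qed
qed

text \<open>
  The form in which reflections are used from now on: any statement about
  \<^const>\<open>reflect\<close> becomes a local one about scans, for an arbitrary reproduced
  state.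
\<close>
lemma reflect_cases:
  obtains (raise) r where "raise_state i w r = r" "reflect i w = raise i w r"
    | (lower) r where "lower_state i w r = r" "reflect i w = lower i w r"
proof (cases "count_list w (Suc i) \<le> count_list w i")
  case True
  show thesis
    by (rule that(1)[OF raise_state_fixed[OF True] reflect_eq_raise[OF raise_state_fixed[OF True]]])
next
  case False
  then have fixed: "lower_state i w (lower_state i w 0) = lower_state i w 0"
    unfolding lower_state_mirror by (intro raise_state_fixed) (simp add: count_list_mirror)
  show thesis
    by (rule that(2)[OF fixed reflect_eq_lower[OF fixed]])
qed

lemma count_list_raise_fixed:
  assumes "raise_state i w r = r"
  shows "count_list (raise i w r) j = count_list w (transpose i (Suc i) j)"
proof -
  note balance = raise_fixed_count(1)[OF assms] count_list_raise_sum[of i w r]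
  consider "j = i" | "j = Suc i" | "j \<noteq> i" "j \<noteq> Suc i" by blast
  then show ?thesis
  proof cases
    case 1
    then show ?thesis using balance by simp
  next
    case 2
    then show ?thesis using balance by simp
  next
    case 3
    then show ?thesis by (simp add: count_list_raise_other)
  qed
qed

lemma count_list_reflect:
  "count_list (reflect i w) j = count_list w (transpose i (Suc i) j)"
proof (cases i w rule: reflect_cases)
  case (raise r)
  then show ?thesis by (simp add: count_list_raise_fixed)
next
  case (lower r)
  then have "raise_state i (mirror i w) r = r" by (simp add: lower_state_mirror)
  then show ?thesis using lower(2)
    by (simp add: lower_mirror count_list_mirror count_list_raise_fixed)
qed

text \<open>
  A scan that reproduces its state may be started at any place of the cyclic word: begin after the
  first letter, in the state reached there, and read that letter last.
\<close>
lemma reflect_rotate1: "reflect i (rotate1 w) = rotate1 (reflect i w)"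
proof (cases w)
  case (Cons x v)
  show ?thesis
  proof (cases i w rule: reflect_cases)
    case (raise r)
    define s where "s = push_state i x r"
    have "raise_state i v s = r" using raise(1) by (simp add: Cons s_def)
    then have "raise_state i (rotate1 w) s = s" and
      "raise i (rotate1 w) s = rotate1 (raise i w r)"
      by (simp_all add: Cons s_def raise_append)
    then show ?thesis using raise(2) reflect_eq_raise[of i "rotate1 w" s] by simp
  next
    case (lower r)
    define s where "s = lower_state i v r"
    have "pull_state i x s = r" using lower(1) by (simp add: Cons s_def)
    then have "lower_state i (rotate1 w) s = s" and
      "lower i (rotate1 w) s = rotate1 (lower i w r)"
      by (simp_all add: Cons s_def lower_append)
    then show ?thesis using lower(2) reflect_eq_lower[of i "rotate1 w" s] by simp
  qed
qed (simp add: reflect_def)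

lemma reflect_rotate: "reflect i (rotate k w) = rotate k (reflect i w)"
  by (induction k) (simp_all add: reflect_rotate1)

section \<open>Knuth relations\<close>

text \<open>
  The two Knuth relations, each listed in both directions.  In the second and third letters of
  \<open>y x z\<close>, and in the first two of \<open>x z y\<close>, a small and a large letter
  are exchanged next to a witness \<open>y\<close> of intermediate size.
\<close>
inductive knuth_window :: "nat list \<Rightarrow> nat list \<Rightarrow> bool" where
  "x \<le> y \<Longrightarrow> y < z \<Longrightarrow> knuth_window [x, z, y] [z, x, y]"
| "x \<le> y \<Longrightarrow> y < z \<Longrightarrow> knuth_window [z, x, y] [x, z, y]"
| "x < y \<Longrightarrow> y \<le> z \<Longrightarrow> knuth_window [y, x, z] [y, z, x]"
| "x < y \<Longrightarrow> y \<le> z \<Longrightarrow> knuth_window [y, z, x] [y, x, z]"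

lemma knuth_window_iff:
  "knuth_window [a, b, c] [d, e, f] \<longleftrightarrow>
     f = c \<and> d = b \<and> e = a \<and> (a \<le> c \<and> c < b \<or> b \<le> c \<and> c < a) \<or>
     d = a \<and> e = c \<and> f = b \<and> (b < a \<and> a \<le> c \<or> c < a \<and> a \<le> b)"
  by (auto simp: knuth_window.simps)

definition knuth_swap :: "nat \<Rightarrow> nat list \<Rightarrow> nat list \<Rightarrow> bool" where
  "knuth_swap p w w' \<longleftrightarrow>
     (\<exists>A u u' B. w = A @ u @ B \<and> w' = A @ u' @ B \<and> length A = p \<and> knuth_window u u')"

lemma knuth_window_length: "knuth_window u u' \<Longrightarrow> length u = 3 \<and> length u' = 3"
  by (erule knuth_window.cases) simp_all

lemma knuth_window_sym: "knuth_window u u' \<Longrightarrow> knuth_window u' u"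
  by (erule knuth_window.cases) (simp_all add: knuth_window.intros)

text \<open>
  The four shapes exclude each other, so a window has at most one partner.  A Knuth relation at a
  fixed place is therefore a partial involution on words, which is what allows fixed points of a
  commuting map to be transported along it.
\<close>
lemma knuth_window_unique: "knuth_window u v \<Longrightarrow> knuth_window u v' \<Longrightarrow> v = v'"
  by (erule knuth_window.cases; erule knuth_window.cases) auto

lemma knuth_swap_sym: "knuth_swap p w w' \<Longrightarrow> knuth_swap p w' w"
  unfolding knuth_swap_def using knuth_window_sym by blast

lemma knuth_swap_unique:
  assumes "knuth_swap p w v" "knuth_swap p w v'"
  shows "v = v'"
proof -
  obtain A u u' B where 1: "w = A @ u @ B" "v = A @ u' @ B" "length A = p" "knuth_window u u'"
    using assms(1) by (auto simp: knuth_swap_def)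
  obtain C t t' D where 2: "w = C @ t @ D" "v' = C @ t' @ D" "length C = p" "knuth_window t t'"
    using assms(2) by (auto simp: knuth_swap_def)
  have "A = C" "u = t" "B = D"
    using 1 2 knuth_window_length[OF 1(4)] knuth_window_length[OF 2(4)] by auto
  then show ?thesis using 1 2 knuth_window_unique by blast
qed


text \<open>
  Exchanging \<open>i\<close> and \<open>i + 1\<close> next to a third bracket alters which
  brackets are matched inside the window, but not what is left for the rest of the word.
\<close>
lemma raise_state_knuth: "knuth_window u u' \<Longrightarrow> raise_state i u r = raise_state i u' r"
  by (erule knuth_window.cases; cases r) (auto simp: push_state_def)

lemma lower_state_knuth: "knuth_window u u' \<Longrightarrow> lower_state i u r = lower_state i u' r"
  by (erule knuth_window.cases; cases r) (auto simp: pull_state_def)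

text \<open>
  A finite check.  If the exchanged letters are not \<open>i\<close> and \<open>i + 1\<close>,
  then the scan treats corresponding letters alike and keeps their relative order; otherwise the
  window is one of \<open>121 \<leftrightarrow> 211\<close> and \<open>212 \<leftrightarrow>
  221\<close> with \<open>i\<close> in place of \<open>1\<close>, and changing the unmatched
  bracket exchanges these two relations or leaves them alone.
\<close>
lemma raise_knuth: "knuth_window u u' \<Longrightarrow> knuth_window (raise i u r) (raise i u' r)"
  by (erule knuth_window.cases; cases r) (auto simp: push_state_def knuth_window_iff)

lemma lower_knuth: "knuth_window u u' \<Longrightarrow> knuth_window (lower i u r) (lower i u' r)"
  by (erule knuth_window.cases; cases r) (auto simp: pull_state_def knuth_window_iff)

lemma knuth_swap_reflect:
  assumes "knuth_swap p w w'"
  shows "knuth_swap p (reflect i w) (reflect i w')"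
proof -
  obtain A u u' B where w: "w = A @ u @ B" "w' = A @ u' @ B" "length A = p" and
    K: "knuth_window u u'"
    using assms by (auto simp: knuth_swap_def)
  show ?thesis
  proof (cases i w rule: reflect_cases)
    case (raise r)
    have "raise_state i w' r = r"
      using raise(1) raise_state_knuth[OF K] by (simp add: w)
    then have "reflect i w' = raise i w' r" by (rule reflect_eq_raise)
    then have 1: "reflect i w' = raise i A r @ raise i u' (raise_state i A r)
        @ raise i B (raise_state i u (raise_state i A r))"
      using raise_state_knuth[OF K] by (simp add: w raise_append)
    have 2: "reflect i w = raise i A r @ raise i u (raise_state i A r)
        @ raise i B (raise_state i u (raise_state i A r))"
      using raise(2) by (simp add: w raise_append)
    show ?thesis
      unfolding knuth_swap_def 1 2 using raise_knuth[OF K] w(3) length_raise by blast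
  next
    case (lower r)
    have "lower_state i w' r = r"
      using lower(1) lower_state_knuth[OF K] by (simp add: w)
    then have "reflect i w' = lower i w' r" by (rule reflect_eq_lower)
    then have 1: "reflect i w' = lower i A (lower_state i u (lower_state i B r))
        @ lower i u' (lower_state i B r) @ lower i B r"
      using lower_state_knuth[OF K] by (simp add: w lower_append)
    have 2: "reflect i w = lower i A (lower_state i u (lower_state i B r))
        @ lower i u (lower_state i B r) @ lower i B r"
      using lower(2) by (simp add: w lower_append)
    show ?thesis
      unfolding knuth_swap_def 1 2 using lower_knuth[OF K] w(3) length_lower by blast
  qed
qed

lemma raise_nondescent: "x \<le> y \<Longrightarrow> raise i [x, y] r ! 0 \<le> raise i [x, y] r ! 1"
  by (cases r) (auto simp: push_state_def)

lemma lower_nondescent: "x \<le> y \<Longrightarrow> lower i [x, y] r ! 0 \<le> lower i [x, y] r ! 1"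
  by (cases r) (auto simp: pull_state_def)

text \<open>
  Of two neighbouring letters \<open>i i\<close> the second is cyclically unmatched if the first
  is, and in \<open>i (i + 1)\<close> a raised \<open>i\<close> still does not exceed its
  neighbour.  Lowering is dual.
\<close>
lemma reflect_nondescent:
  assumes "Suc k < length w" "w ! k \<le> w ! Suc k"
  shows "reflect i w ! k \<le> reflect i w ! Suc k"
proof -
  define A B where "A = take k w" and "B = drop (Suc (Suc k)) w"
  have w: "w = A @ [w ! k, w ! Suc k] @ B" and A: "length A = k"
    using assms(1) by (simp_all add: A_def B_def Cons_nth_drop_Suc)
  let ?u = "[w ! k, w ! Suc k]"
  obtain A' u B' where "reflect i w = A' @ u @ B'" "length A' = k" "length u = 2" "u ! 0 \<le> u ! 1"
  proof (cases i w rule: reflect_cases)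
    case (raise r)
    show thesis
    proof (rule that)
      show "reflect i w = raise i A r @ raise i ?u (raise_state i A r)
          @ raise i B (raise_state i ?u (raise_state i A r))"
        unfolding raise(2) by (subst (1) w) (simp only: raise_append)
    qed (use A raise_nondescent[OF assms(2)] in simp_all)
  next
    case (lower r)
    show thesis
    proof (rule that)
      show "reflect i w = lower i A (lower_state i ?u (lower_state i B r))
          @ lower i ?u (lower_state i B r) @ lower i B r"
        unfolding lower(2) by (subst (1) w) (simp only: lower_append foldr_append comp_apply)
    qed (use A lower_nondescent[OF assms(2)] in simp_all)
  qed
  then show ?thesis by (simp add: nth_append)
qed

lemma sorted_reflect: "sorted w \<Longrightarrow> sorted (reflect i w)"
  by (simp add: sorted_iff_nth_Suc reflect_nondescent)

section \<open>Rotations and Knuth relations connect every word with a sorted one\<close>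

text \<open>
  First half of a row insertion: \<open>y\<close> moves to the left through the larger letters of
  the row, up to the letter \<open>v\<close> that it will bump.  The left neighbour in the row of
  the letter being passed serves as witness; the property \<open>P\<close> is carried along.
\<close>
lemma knuth_bump_right:
  assumes knuth: "\<And>p w w'. knuth_swap p w w' \<Longrightarrow> P w' \<Longrightarrow> P w"
    and "sorted (v # B)" "y < v" "P (C @ v # y # B @ D)"
  shows "P (C @ v # B @ y # D)"
  using assms(2-)
proof (induction B arbitrary: D rule: rev_induct)
  case (snoc b B)
  \<comment> \<open>The witness: the letter to the left of \<open>b\<close>, which is \<open>v\<close> itself if \<open>B\<close> is empty.\<close>
  define a where "a = last (v # B)"
  have split: "v # B = butlast (v # B) @ [a]" by (simp add: a_def)
  have "y < a"
    using snoc.prems(1,2) unfolding a_def by (cases B rule: rev_cases) auto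
  moreover have "a \<le> b"
    using snoc.prems(1) unfolding a_def by (cases B rule: rev_cases) (auto simp: sorted_append)
  ultimately have K: "knuth_window [a, b, y] [a, y, b]"
    by (intro knuth_window.intros)
  have "P (C @ v # B @ y # b # D)"
    using snoc.prems by (intro snoc.IH) (auto simp: sorted_append)
  moreover have "C @ v # B @ y # b # D = (C @ butlast (v # B)) @ [a, y, b] @ D"
    using split by (metis append.assoc append_Cons append_Nil)
  moreover have "C @ v # (B @ [b]) @ y # D = (C @ butlast (v # B)) @ [a, b, y] @ D"
    using split by (metis append.assoc append_Cons append_Nil)
  ultimately show ?case
    using knuth K unfolding knuth_swap_def by metis
qed simp

text \<open>
  Second half of a row insertion: the bumped letter \<open>v\<close> leaves the row on the left.
  It passes letters at most \<open>y\<close>, and the right neighbour in the row of the letter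
  being passed serves as witness.
\<close>
lemma knuth_bump_left:
  assumes knuth: "\<And>p w w'. knuth_swap p w w' \<Longrightarrow> P w' \<Longrightarrow> P w"
    and "sorted (A @ [y])" "y < v" "P (C @ v # A @ y # D)"
  shows "P (C @ A @ v # y # D)"
  using assms(2-)
proof (induction A arbitrary: y D rule: rev_induct)
  case (snoc a A)
  have "a \<le> y" using snoc.prems(1) by (auto simp: sorted_append)
  then have K: "knuth_window [a, v, y] [v, a, y]"
    using snoc.prems(2) by (intro knuth_window.intros)
  have "P (C @ A @ v # a # y # D)"
    using snoc.prems \<open>a \<le> y\<close> by (intro snoc.IH) (auto simp: sorted_append)
  then have "P ((C @ A) @ [v, a, y] @ D)" by simp
  moreover have "knuth_swap (length (C @ A)) ((C @ A) @ [a, v, y] @ D) ((C @ A) @ [v, a, y] @ D)"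
    using K unfolding knuth_swap_def by blast
  ultimately show ?case
    using knuth by fastforce
qed simp

text \<open>
  The word is written as \<open>V @ u\<close> with \<open>V\<close> sorted.  Inserting the first
  letter of \<open>u\<close> into \<open>V\<close> either lengthens \<open>V\<close>, or bumps out
  a larger letter, which a rotation moves to the end of \<open>u\<close>.  In the second case
  \<open>u\<close> keeps its length but the sum of \<open>V\<close> drops, so the process ends
  with \<open>u\<close> empty.
\<close>
lemma knuth_rotate_induct:
  assumes sorted: "\<And>w. sorted w \<Longrightarrow> P w"
    and knuth: "\<And>p w w'. knuth_swap p w w' \<Longrightarrow> P w' \<Longrightarrow> P w"
    and rotate: "\<And>k w. P (rotate k w) \<Longrightarrow> P w"
  shows "P w"
proof -
  have "P (V @ u)" if "length u = N" "sorted V" for N u V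
    using that
  proof (induction N arbitrary: u V)
    case 0
    then show ?case using sorted by simp
  next
    case (Suc N)
    have "P (V @ u)" if "length u = Suc N" "sorted V" "sum_list V = S" for u V S
      using that
    proof (induction S arbitrary: u V rule: less_induct)
      case (less S)
      obtain y u' where u: "u = y # u'" "length u' = N"
        using less.prems(1) by (cases u) auto
      show ?case
      proof (cases "sorted (V @ [y])")
        case True
        then have "P ((V @ [y]) @ u')" using Suc.IH u(2) by blast
        then show ?thesis by (simp add: u)
      next
        case False
        define A where "A = takeWhile (\<lambda>x. x \<le> y) V"
        have "dropWhile (\<lambda>x. x \<le> y) V \<noteq> []"
          using False less.prems(2) by (auto simp: sorted_append dropWhile_eq_Nil_conv)
        then obtain v B where B: "dropWhile (\<lambda>x. x \<le> y) V = v # B"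
          by (cases "dropWhile (\<lambda>x. x \<le> y) V") auto
        then have V: "V = A @ v # B"
          unfolding A_def by (metis takeWhile_dropWhile_id)
        have v: "y < v"
          using B by (metis hd_dropWhile list.distinct(1) list.sel(1) not_less)
        have A: "\<forall>x\<in>set A. x \<le> y"
          unfolding A_def by (auto dest: set_takeWhileD)
        have "sorted (A @ y # B)"
          using less.prems(2) A v by (auto simp: V sorted_append)
        moreover have "sum_list (A @ y # B) < S"
          using less.prems(3) v by (simp add: V)
        ultimately have "P ((A @ y # B) @ u' @ [v])"
          using less.IH[of "sum_list (A @ y # B)" "u' @ [v]" "A @ y # B"] u(2) by simp
        moreover have "(A @ y # B) @ u' @ [v] = rotate (length [v]) ([v] @ A @ y # B @ u')"
          unfolding rotate_append by simp
        ultimately have "P ([v] @ A @ y # B @ u')" using rotate by metis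
        then have 1: "P ([] @ v # A @ y # B @ u')" by simp
        have 2: "sorted (A @ [y])" and 3: "sorted (v # B)"
          using less.prems(2) A by (auto simp: V sorted_append)
        have "P ([] @ A @ v # y # B @ u')"
          by (rule knuth_bump_left[of P A y v "[]" "B @ u'", OF _ 2 v 1]) (erule knuth)
        then have 4: "P (A @ v # y # B @ u')" by simp
        have "P (A @ v # B @ y # u')"
          by (rule knuth_bump_right[of P v B y A u', OF _ 3 v 4]) (erule knuth)
        then show ?thesis by (simp add: V u)
      qed
    qed
    then show ?case using Suc.prems by blast
  qed
  from this[of w "length w" "[]"] show ?thesis by simp
qed

section \<open>The cycle of reflections on words has order dividing \<open>n\<close>\<close>

definition word_cycle :: "nat \<Rightarrow> nat list \<Rightarrow> nat list" where
  "word_cycle n = fold reflect [1..<n]"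

text \<open>
  The effect on contents: letter \<open>j\<close> of the new word is as frequent as letter
  \<open>shift n j\<close> was in the old one.
\<close>
definition shift :: "nat \<Rightarrow> nat \<Rightarrow> nat" where
  "shift n j = (if 1 \<le> j \<and> j < n then Suc j else if 1 \<le> j \<and> j = n then 1 else j)"

lemma shift_funpow:
  assumes "1 \<le> j" "j \<le> n"
  shows "(shift n ^^ k) j = (j - 1 + k) mod n + 1"
proof (induction k)
  case 0
  then show ?case using assms by simp
next
  case (Suc k)
  have "(j - 1 + k) mod n < n" using assms by simp
  then show ?case using Suc by (auto simp: shift_def mod_Suc)
qed

lemma shift_funpow_outside:
  assumes "\<not> (1 \<le> j \<and> j \<le> n)"
  shows "(shift n ^^ k) j = j"
  using assms by (induction k) (auto simp: shift_def)

lemma shift_funpow_eq_id_iff: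
  assumes "n \<ge> 1"
  shows "shift n ^^ k = id \<longleftrightarrow> n dvd k"
proof
  assume "shift n ^^ k = id"
  then show "n dvd k"
    using shift_funpow[of 1 n k] assms by (simp add: mod_eq_0_iff_dvd)
next
  assume "n dvd k"
  then obtain q where k: "k = n * q" ..
  show "shift n ^^ k = id"
  proof
    fix j
    show "(shift n ^^ k) j = id j"
    proof (cases "1 \<le> j \<and> j \<le> n")
      case True
      have "(j - 1 + n * q) mod n = (j - 1) mod n" by simp
      moreover have "(j - 1) mod n = j - 1" using True by (intro mod_less) linarith
      ultimately have "(j - 1 + n * q) mod n + 1 = j" using True by linarith
      then show ?thesis using True shift_funpow[of j n k] unfolding k by simp
    next
      case False
      then show ?thesis by (simp add: shift_funpow_outside)
    qed
  qed
qed

lemma count_list_word_cycle: "count_list (word_cycle n w) j = count_list w (shift n j)"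
proof (induction n arbitrary: j)
  case 0
  then show ?case by (simp add: word_cycle_def shift_def)
next
  case (Suc m)
  show ?case
  proof (cases "m = 0")
    case True
    then show ?thesis by (simp add: word_cycle_def shift_def)
  next
    case False
    then have "word_cycle (Suc m) w = reflect m (word_cycle m w)"
      by (simp add: word_cycle_def)
    moreover have "shift m (transpose m (Suc m) j) = shift (Suc m) j"
      using False by (auto simp: shift_def transpose_def)
    ultimately show ?thesis by (simp add: count_list_reflect Suc.IH)
  qed
qed

lemma count_list_word_cycle_funpow:
  "count_list ((word_cycle n ^^ k) w) j = count_list w ((shift n ^^ k) j)"
  by (induction k arbitrary: j) (simp_all add: count_list_word_cycle flip: funpow_swap1)

lemma word_cycle_funpow_invariant:
  assumes "\<And>i w. Q w \<Longrightarrow> Q (reflect i w)" "Q w"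
  shows "Q ((word_cycle n ^^ k) w)"
proof -
  have "Q (fold reflect js v)" if "Q v" for js v
    using that by (induction js arbitrary: v) (auto intro: assms(1))
  then show ?thesis
    using assms(2) by (induction k) (auto simp: word_cycle_def)
qed

lemma knuth_swap_word_cycle_funpow:
  assumes "knuth_swap p w w'"
  shows "knuth_swap p ((word_cycle n ^^ k) w) ((word_cycle n ^^ k) w')"
proof -
  have "knuth_swap p (fold reflect js v) (fold reflect js v')" if "knuth_swap p v v'" for js v v'
    using that by (induction js arbitrary: v v') (auto intro: knuth_swap_reflect)
  then show ?thesis
    using assms by (induction k) (auto simp: word_cycle_def)
qed

lemma word_cycle_funpow_rotate:
  "(word_cycle n ^^ k) (rotate l w) = rotate l ((word_cycle n ^^ k) w)"
proof -
  have "fold reflect js (rotate l v) = rotate l (fold reflect js v)" for js v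
    by (induction js arbitrary: v) (auto simp: reflect_rotate)
  then show ?thesis
    by (induction k) (auto simp: word_cycle_def)
qed

lemma rotate_inject: "rotate l v = rotate l w \<Longrightarrow> v = w"
proof (induction l)
  case (Suc l)
  have inj: "x = y" if "rotate1 x = rotate1 y" for x y :: "'a list"
    using that by (cases x; cases y) auto
  from Suc.prems have "rotate1 (rotate l v) = rotate1 (rotate l w)" by simp
  from Suc.IH[OF inj[OF this]] show ?case .
qed simp

text \<open>
  The iterate \<open>f = (word_cycle n)\<^sup>n\<close> preserves all multiplicities.  A sorted
  word is determined by them, and \<open>f\<close> preserves sortedness.  If \<open>w'\<close> is
  fixed and \<open>w\<close> is its Knuth partner at some place, then \<open>f w\<close> is a
  Knuth partner of \<open>f w' = w'\<close> at that place too, so \<open>f w = w\<close>.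
  Rotation is injective and commutes with \<open>f\<close>.
\<close>
lemma word_cycle_funpow_n:
  "(word_cycle n ^^ n) w = w"
proof (induction w rule: knuth_rotate_induct)
  case (1 w)
  have shift: "shift n ^^ n = id"
  proof (cases "n = 0")
    case False
    then show ?thesis by (subst shift_funpow_eq_id_iff) auto
  qed simp
  have "sorted ((word_cycle n ^^ n) w)"
    using word_cycle_funpow_invariant[of sorted] sorted_reflect 1 by blast
  moreover have "mset ((word_cycle n ^^ n) w) = mset w"
    by (rule multiset_eqI) (simp add: count_mset count_list_word_cycle_funpow shift)
  ultimately show ?case
    using 1 properties_for_sort by metis
next
  case (2 p w w')
  have "knuth_swap p w' ((word_cycle n ^^ n) w)"
    using knuth_swap_word_cycle_funpow[OF knuth_swap_sym[OF 2(1)], of n n] 2(2) by simp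
  then show ?case
    using knuth_swap_unique[OF knuth_swap_sym[OF 2(1)]] by metis
next
  case (3 k w)
  then have "rotate k ((word_cycle n ^^ n) w) = rotate k w"
    by (simp add: word_cycle_funpow_rotate)
  then show ?case by (rule rotate_inject)
qed

section \<open>The operators on fillings act on reading words\<close>

lemma set_unmatched_aux:
  assumes "unmatched_aux T i cs os ks = (cl, op)"
  shows "\<exists>cl'. cl = rev ks @ cl' \<and> set cl' \<subseteq> {x \<in> set cs. T x = i} \<and> (distinct cs \<longrightarrow> distinct cl')"
    and "set op \<subseteq> set os \<union> {x \<in> set cs. T x = Suc i}"
proof -
  have "(\<exists>cl'. cl = rev ks @ cl' \<and> set cl' \<subseteq> {x \<in> set cs. T x = i} \<and> (distinct cs \<longrightarrow> distinct cl')) \<and>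
    set op \<subseteq> set os \<union> {x \<in> set cs. T x = Suc i}"
    using assms
  proof (induction cs arbitrary: os ks)
    case (Cons c cs)
    consider (opener) "T c = Suc i" | (match) x xs where "T c = i" "os = x # xs"
      | (unmatched) "T c = i" "os = []" | (other) "T c \<noteq> i" "T c \<noteq> Suc i"
      by (cases os) auto
    then show ?case
    proof cases
      case opener
      then show ?thesis using Cons.prems Cons.IH[of "c # os" ks] by auto
    next
      case match
      then show ?thesis using Cons.prems Cons.IH[of xs ks] by auto
    next
      case unmatched
      then obtain cl' where "cl = rev ks @ c # cl'" "set cl' \<subseteq> {x \<in> set cs. T x = i}"
        "distinct cs \<longrightarrow> distinct cl'" "set op \<subseteq> {x \<in> set cs. T x = Suc i}"
        using Cons.prems Cons.IH[of "[]" "c # ks"] by auto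
      then show ?thesis using unmatched by (intro conjI exI[of _ "c # cl'"]) auto
    next
      case other
      then show ?thesis using Cons.prems Cons.IH[of os ks] by auto
    qed
  qed auto
  then show "\<exists>cl'. cl = rev ks @ cl' \<and> set cl' \<subseteq> {x \<in> set cs. T x = i} \<and> (distinct cs \<longrightarrow> distinct cl')"
    and "set op \<subseteq> set os \<union> {x \<in> set cs. T x = Suc i}"
    by blast+
qed

text \<open>
  Linear matching with stack \<open>os\<close> is compared with the scan that has \<open>b\<close>
  additional openings waiting in advance.  The first \<open>b\<close> linearly unmatched closings
  use these up, so exactly the later ones are raised.  The number \<open>b\<close> will be the
  number of linearly unmatched openings, which makes the scan reproduce its state and agree with
  the rule \<open>i\<^sup>a (i+1)\<^sup>b \<mapsto> i\<^sup>b (i+1)\<^sup>a\<close> when \<open>b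
  \<le> a\<close>.
\<close>
lemma raise_unmatched:
  fixes b :: nat
  assumes "unmatched_aux T i cs os ks = (cl, op)" "distinct (cs @ ks)"
  defines "r \<equiv> length os + (b - length ks)"
  shows "raise_state i (map T cs) r = length op + (b - length cl)"
    and "raise i (map T cs) r
           = map (\<lambda>x. if x \<in> set (drop b cl) then Suc i else T x) cs"
proof -
  have "raise_state i (map T cs) r = length op + (b - length cl) \<and>
    raise i (map T cs) r = map (\<lambda>x. if x \<in> set (drop b cl) then Suc i else T x) cs"
    using assms(1,2) unfolding r_def
  proof (induction cs arbitrary: os ks)
    case (Cons c cs)
    obtain cl' where cl': "cl = rev ks @ cl'" "set cl' \<subseteq> {x \<in> set (c # cs). T x = i}"
      using set_unmatched_aux(1)[OF Cons.prems(1)] by blast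
    consider (opener) "T c = Suc i" | (match) x xs where "T c = i" "os = x # xs"
      | (unmatched) "T c = i" "os = []" | (other) "T c \<noteq> i" "T c \<noteq> Suc i"
      by (cases os) auto
    then show ?case
    proof cases
      case opener
      have "c \<notin> set (drop b cl)"
        using cl' opener Cons.prems(2) by (auto dest!: in_set_dropD)
      then show ?thesis
        using opener Cons.prems Cons.IH[of "c # os" ks] by (simp add: push_state_def)
    next
      case match
      obtain cl'' where cl'': "cl = rev ks @ cl''" "set cl'' \<subseteq> {x \<in> set cs. T x = i}"
        using set_unmatched_aux(1)[of T i cs xs ks cl op] Cons.prems(1) match by auto
      have "c \<notin> set (drop b cl)"
        using cl'' Cons.prems(2) by (auto dest!: in_set_dropD)
      then show ?thesis
        using match Cons.prems Cons.IH[of xs ks] by (simp add: push_state_def)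
    next
      case unmatched
      have aux: "unmatched_aux T i cs [] (c # ks) = (cl, op)"
        using Cons.prems(1) unmatched by simp
      obtain cl'' where cl'': "cl = rev ks @ c # cl''" "set cl'' \<subseteq> {x \<in> set cs. T x = i}"
        using set_unmatched_aux(1)[OF aux] by auto
      have "c \<in> set (drop b cl) \<longleftrightarrow> b - length ks = 0"
        using cl'' Cons.prems(2) by (cases "b - length ks") (auto dest!: in_set_dropD)
      then show ?thesis
        using unmatched aux Cons.prems(2) Cons.IH[of "[]" "c # ks"]
        by (simp add: push_state_def)
    next
      case other
      have "c \<notin> set (drop b cl)"
        using cl' other Cons.prems(2) by (auto dest!: in_set_dropD)
      then show ?thesis
        using other Cons.prems Cons.IH[of os ks] by (simp add: push_state_def)
    qed
  qed auto
  then show "raise_state i (map T cs) r = length op + (b - length cl)"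
    and "raise i (map T cs) r = map (\<lambda>x. if x \<in> set (drop b cl) then Suc i else T x) cs"
    by blast+
qed

text \<open>
  A stack of pending openings meets the first unmatched closings of the remaining word.  This
  allows the matching to be computed from right to left as well.
\<close>
lemma unmatched_aux_eq:
  "unmatched_aux T i cs os ks =
     (let (cl, op) = unmatched T i cs in
       (rev ks @ drop (length os) cl, rev (drop (length cl) os) @ op))"
proof (induction cs arbitrary: os ks)
  case (Cons c cs)
  obtain cl op where u: "unmatched T i cs = (cl, op)" by fastforce
  have IH: "unmatched_aux T i cs os ks
      = (rev ks @ drop (length os) cl, rev (drop (length cl) os) @ op)" for os ks
    by (subst Cons.IH) (simp add: u)
  show ?case
    by (cases os; cases cl) (simp_all add: unmatched_def IH)
qed (simp add: unmatched_def)

lemma unmatched_Cons: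
  assumes "unmatched T i cs = (cl, op)"
  shows "unmatched T i (c # cs) =
     (if T c = Suc i then (case cl of [] \<Rightarrow> ([], c # op) | _ # cl' \<Rightarrow> (cl', op))
      else if T c = i then (c # cl, op) else (cl, op))"
proof -
  have aux: "unmatched_aux T i cs os ks
      = (rev ks @ drop (length os) cl, rev (drop (length cl) os) @ op)" for os ks
    by (subst unmatched_aux_eq) (simp add: assms)
  show ?thesis
    by (cases cl) (simp_all add: unmatched_def aux)
qed

lemma pull_state_simps:
  "pull_state i i r = Suc r"
  "pull_state i (Suc i) r = r - 1"
  "x \<noteq> i \<Longrightarrow> x \<noteq> Suc i \<Longrightarrow> pull_state i x r = r"
  by (simp_all add: pull_state_def)

text \<open>
  The counterpart of \<open>raise_unmatched\<close> for \<open>a < b\<close>: with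
  \<open>a\<close> closings waiting beyond the end, the last \<open>a\<close> linearly unmatched
  openings are used up, and the earlier ones are lowered.
\<close>
lemma lower_unmatched:
  assumes "unmatched T i cs = (cl, op)" "distinct cs"
  shows "lower_state i (map T cs) a = length cl + (a - length op)"
    and "lower i (map T cs) a
           = map (\<lambda>x. if x \<in> set (take (length op - a) op) then i else T x) cs"
proof -
  have "lower_state i (map T cs) a = length cl + (a - length op) \<and>
    lower i (map T cs) a = map (\<lambda>x. if x \<in> set (take (length op - a) op) then i else T x) cs"
    using assms
  proof (induction cs arbitrary: cl op)
    case (Cons c cs)
    obtain cl' op' where u: "unmatched T i cs = (cl', op')" by fastforce
    have IH: "lower_state i (map T cs) a = length cl' + (a - length op')"
      "lower i (map T cs) a = map (\<lambda>x. if x \<in> set (take (length op' - a) op') then i else T x) cs"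
      using Cons u by auto
    have op': "set op' \<subseteq> set cs"
      using set_unmatched_aux(2)[of T i cs "[]" "[]" cl' op'] u by (auto simp: unmatched_def)
    have c: "c \<notin> set op'" "c \<notin> set (take k op')" for k
      using op' Cons.prems(2) by (auto dest: in_set_takeD)
    show ?case
    proof (cases "T c = Suc i \<and> cl' = []")
      case True
      then have *: "cl = []" "op = c # op'"
        using Cons.prems(1) unmatched_Cons[OF u, of c] by auto
      show ?thesis
      proof (cases "length op' < a")
        case True
        then show ?thesis
          using * IH \<open>T c = Suc i \<and> cl' = []\<close> by (simp add: pull_state_simps)
      next
        case False
        then have "length op - a = Suc (length op' - a)" using * by simp
        then show ?thesis
          using * IH \<open>T c = Suc i \<and> cl' = []\<close> False c Cons.prems(2)
          by (auto simp: pull_state_simps)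
      qed
    next
      case False
      then have "op = op'" using Cons.prems(1) unmatched_Cons[OF u, of c]
        by (auto split: if_splits list.splits)
      then show ?thesis
        using False IH c Cons.prems(1) unmatched_Cons[OF u, of c]
        by (auto simp: pull_state_simps split: if_splits list.splits)
    qed
  qed (simp add: unmatched_def)
  then show "lower_state i (map T cs) a = length cl + (a - length op)"
    and "lower i (map T cs) a
           = map (\<lambda>x. if x \<in> set (take (length op - a) op) then i else T x) cs"
    by blast+
qed

lemma distinct_reading_order: "distinct (reading_order lam mu)"
proof -
  have "distinct (concat (map (\<lambda>i. map (Pair i) [part mu i..<part lam i]) xs))" if "distinct xs" for xs
    using that by (induction xs) (auto simp: distinct_map inj_on_def)
  then show ?thesis by (simp add: reading_order_def)
qed

lemma set_reading_order: "set (reading_order lam mu) = boxes lam mu"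
  by (auto simp: reading_order_def boxes_def part_def split: if_splits)

text \<open>
  With \<open>a\<close> unmatched closings and \<open>b\<close> unmatched openings, the rule
  \<open>i\<^sup>a (i+1)\<^sup>b \<mapsto> i\<^sup>b (i+1)\<^sup>a\<close> raises the last
  \<open>a - b\<close> closings if \<open>b \<le> a\<close> and lowers the first \<open>b -
  a\<close> openings if \<open>a < b\<close>.  These are the changes made by the cyclic scan, with
  \<open>b\<close> respectively \<open>a\<close> as reproduced state.
\<close>
lemma map_crystal_reflection:
  "map (crystal_reflection lam mu i T) (reading_order lam mu)
     = reflect i (map T (reading_order lam mu))"
proof -
  define cs where "cs = reading_order lam mu"
  have d: "distinct cs" unfolding cs_def by (rule distinct_reading_order)
  obtain cl op where u: "unmatched T i cs = (cl, op)" by fastforce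
  define b where "b = length op"
  have "distinct cl"
    using set_unmatched_aux(1)[of T i cs "[]" "[]" cl op] u d by (auto simp: unmatched_def)
  have T': "crystal_reflection lam mu i T = (\<lambda>c. if c \<in> set (take b (cl @ op)) then i
      else if c \<in> set (drop b (cl @ op)) then Suc i else T c)"
    unfolding crystal_reflection_def cs_def[symmetric] u b_def by (simp add: Let_def)
  have cl: "T x = i" if "x \<in> set cl" for x
    using set_unmatched_aux(1)[of T i cs "[]" "[]" cl op] u that by (auto simp: unmatched_def)
  have op: "T x = Suc i" if "x \<in> set op" for x
    using set_unmatched_aux(2)[of T i cs "[]" "[]" cl op] u that by (auto simp: unmatched_def)
  have "map (crystal_reflection lam mu i T) cs = reflect i (map T cs)"
  proof (cases "b \<le> length cl")
    case True
    note r = raise_unmatched[of T i cs "[]" "[]" cl op b, folded unmatched_def, OF u]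
    have "raise_state i (map T cs) b = b"
      using r(1) d True by (simp add: b_def)
    then have "reflect i (map T cs) = raise i (map T cs) b" by (rule reflect_eq_raise)
    moreover have "crystal_reflection lam mu i T x = (if x \<in> set (drop b cl) then Suc i else T x)" for x
    proof -
      have "\<not> (x \<in> set (take b cl) \<and> x \<in> set (drop b cl))"
        using \<open>distinct cl\<close> by (metis append_take_drop_id disjoint_iff distinct_append)
      then show ?thesis
      using True cl[of x] op[of x] by (auto simp: T' dest: in_set_takeD in_set_dropD)
    qed
    ultimately show ?thesis using r(2) d by simp
  next
    case False
    note r = lower_unmatched[OF u d, of "length cl"]
    have "lower_state i (map T cs) (length cl) = length cl"
      using r(1) False by (simp add: b_def)
    then have "reflect i (map T cs) = lower i (map T cs) (length cl)" by (rule reflect_eq_lower)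
    moreover have "crystal_reflection lam mu i T x
        = (if x \<in> set (take (length op - length cl) op) then i else T x)" for x
      using False cl[of x] op[of x] by (auto simp: T' b_def dest: in_set_takeD in_set_dropD)
    ultimately show ?thesis using r(2) by simp
  qed
  then show ?thesis unfolding cs_def .
qed

lemma crystal_reflection_outside:
  assumes "c \<notin> boxes lam mu"
  shows "crystal_reflection lam mu i T c = T c"
proof -
  obtain cl op where u: "unmatched T i (reading_order lam mu) = (cl, op)" by fastforce
  have "set cl \<union> set op \<subseteq> boxes lam mu"
    using set_unmatched_aux[of T i "reading_order lam mu" "[]" "[]" cl op] u
    by (auto simp: unmatched_def set_reading_order)
  then show ?thesis
    using assms by (auto simp: crystal_reflection_def u Let_def dest: in_set_takeD in_set_dropD)
qed

lemma map_crystal_cycle_funpow: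
  "map ((crystal_cycle lam mu n ^^ k) T) (reading_order lam mu)
     = (word_cycle n ^^ k) (map T (reading_order lam mu))"
proof -
  have fold: "map (fold (crystal_reflection lam mu) js S) (reading_order lam mu)
      = fold reflect js (map S (reading_order lam mu))" for js S
    by (induction js arbitrary: S) (simp_all add: map_crystal_reflection)
  show ?thesis
    by (induction k) (simp_all add: crystal_cycle_def word_cycle_def fold)
qed

lemma crystal_cycle_funpow_outside:
  assumes "c \<notin> boxes lam mu"
  shows "(crystal_cycle lam mu n ^^ k) T c = T c"
proof -
  have fold: "fold (crystal_reflection lam mu) js S c = S c" for js S
    using assms by (induction js arbitrary: S) (simp_all add: crystal_reflection_outside)
  show ?thesis
    by (induction k) (simp_all add: crystal_cycle_def fold)
qed

text \<open>
  Since \<open>T\<close> may be any filling, this gives the group action on every set of fillings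
  that the crystal cycle maps to itself.
\<close>
lemma crystal_cycle_funpow_n: "(crystal_cycle lam mu n ^^ n) T = T"
proof
  fix c
  show "(crystal_cycle lam mu n ^^ n) T c = T c"
  proof (cases "c \<in> boxes lam mu")
    case True
    have "map ((crystal_cycle lam mu n ^^ n) T) (reading_order lam mu) = map T (reading_order lam mu)"
      by (simp add: map_crystal_cycle_funpow word_cycle_funpow_n)
    then show ?thesis using True by (simp add: set_reading_order)
  qed (simp add: crystal_cycle_funpow_outside)
qed

lemma weight_eq_count_list: "weight lam mu T i = count_list (map T (reading_order lam mu)) i"
proof -
  have "card {c \<in> set cs. T c = i} = count_list (map T cs) i" if "distinct cs" for cs
    using that
  proof (induction cs)
    case (Cons c cs)
    have "{x \<in> set (c # cs). T x = i}
        = (if T c = i then insert c {x \<in> set cs. T x = i} else {x \<in> set cs. T x = i})"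
      by auto
    then show ?case using Cons by simp
  qed simp
  from this[OF distinct_reading_order] show ?thesis
    by (simp add: weight_def set_reading_order)
qed

lemma weight_crystal_cycle:
  "weight lam mu (crystal_cycle lam mu n T) j = weight lam mu T (shift n j)"
  using map_crystal_cycle_funpow[where k = 1 and n = n and T = T and lam = lam and mu = mu]
  by (simp add: weight_eq_count_list count_list_word_cycle)

section \<open>Reflections preserve semistandard tableaux\<close>

text \<open>
  A stretch with more openings than closings leaves an opening waiting, whatever came before.
\<close>
lemma raise_state_pos:
  assumes "count_list U i < count_list U (Suc i)"
  shows "0 < raise_state i U r"
  using raise_state_balance[of i U r] count_list_raise_le[of i U r] assms by linarith

lemma lower_state_pos:
  assumes "count_list U (Suc i) < count_list U i"
  shows "0 < lower_state i U r"
  unfolding lower_state_mirror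
  by (rule raise_state_pos) (simp add: count_list_mirror assms)

text \<open>
  The closing bracket after \<open>U\<close> finds an opening waiting, so it is matched; and when
  letters are lowered, closing brackets are never touched.
\<close>
lemma reflect_keeps_closer:
  assumes "count_list U i < count_list U (Suc i)"
  shows "reflect i (A @ U @ i # B) ! length (A @ U) = i"
proof (cases i "A @ U @ i # B" rule: reflect_cases)
  case (raise r)
  have "0 < raise_state i U (raise_state i A r)" by (rule raise_state_pos[OF assms])
  then show ?thesis
    by (simp add: raise(2) raise_append nth_append)
next
  case (lower r)
  show ?thesis
    by (simp add: lower(2) lower_append nth_append)
qed

lemma reflect_keeps_opener:
  assumes "count_list U (Suc i) < count_list U i"
  shows "reflect i (A @ Suc i # U @ B) ! length A = Suc i"
proof (cases i "A @ Suc i # U @ B" rule: reflect_cases)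
  case (raise r)
  show ?thesis
    by (simp add: raise(2) raise_append nth_append)
next
  case (lower r)
  have "0 < lower_state i U (lower_state i B r)" by (rule lower_state_pos[OF assms])
  then show ?thesis
    by (simp add: lower(2) lower_append nth_append)
qed

lemma crystal_reflection_nth:
  assumes "reading_order lam mu = A @ c # B"
  shows "crystal_reflection lam mu i T c = reflect i (map T (reading_order lam mu)) ! length A"
proof -
  have "map (crystal_reflection lam mu i T) (reading_order lam mu) ! length A
      = crystal_reflection lam mu i T c"
    by (simp add: assms nth_append)
  then show ?thesis by (simp add: map_crystal_reflection)
qed

lemma part_Suc_le: "is_partition lam \<Longrightarrow> part lam (Suc k) \<le> part lam k"
  using sorted_wrt_nth_less[of "(\<ge>)" lam k "Suc k"] by (auto simp: is_partition_def part_def)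

lemma part_antimono: "is_partition lam \<Longrightarrow> k \<le> l \<Longrightarrow> part lam l \<le> part lam k"
  by (rule lift_Suc_antimono_le[of "part lam"]) (auto intro: part_Suc_le)

lemma boxes_iff: "(k, j) \<in> boxes lam mu \<longleftrightarrow> part mu k \<le> j \<and> j < part lam k"
  by (simp add: boxes_def)

lemma reading_order_row:
  assumes "k < length lam"
  obtains P Q where "reading_order lam mu = P @ map (Pair k) [part mu k..<part lam k] @ Q"
proof -
  have "[0..<length lam] = [0..<k] @ k # [Suc k..<length lam]"
    using assms upt_add_eq_append[of 0 k "length lam - k"] by (simp add: upt_conv_Cons)
  then show thesis by (intro that) (simp add: reading_order_def)
qed

lemma reading_order_two_rows:
  assumes "Suc k < length lam"
  obtains P Q where "reading_order lam mu =
    P @ map (Pair (Suc k)) [part mu (Suc k)..<part lam (Suc k)]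
      @ map (Pair k) [part mu k..<part lam k] @ Q"
proof -
  have "[0..<length lam] = [0..<k] @ k # Suc k # [Suc (Suc k)..<length lam]"
    using assms upt_add_eq_append[of 0 k "length lam - k"] by (simp add: upt_conv_Cons)
  then show thesis by (intro that) (simp add: reading_order_def)
qed

lemma upt_split: "a \<le> b \<Longrightarrow> b \<le> c \<Longrightarrow> [a..<c] = [a..<b] @ [b..<c]"
  using upt_add_eq_append[of a b "c - b"] by simp

lemma count_list_map_const:
  "(\<And>x. x \<in> set xs \<Longrightarrow> f x = v) \<Longrightarrow> count_list (map f xs) v = length xs"
  by (induction xs) auto

lemma count_list_map_avoid:
  "(\<And>x. x \<in> set xs \<Longrightarrow> f x \<noteq> v) \<Longrightarrow> count_list (map f xs) v = 0"
  by (induction xs) auto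

lemma SSYT_row_le:
  assumes "T \<in> SSYT lam mu n" "(k, j) \<in> boxes lam mu" "(k, j') \<in> boxes lam mu" "j \<le> j'"
  shows "T (k, j) \<le> T (k, j')"
  using assms by (cases "j = j'") (auto simp: SSYT_def)

lemma SSYT_column_less:
  assumes "T \<in> SSYT lam mu n" "(k, j) \<in> boxes lam mu" "(k', j) \<in> boxes lam mu" "k < k'"
  shows "T (k, j) < T (k', j)"
  using assms by (auto simp: SSYT_def)

text \<open>
  A column \<open>i\<close> above \<open>i + 1\<close> must not become \<open>i + 1\<close> above
  \<open>i + 1\<close>.  Let \<open>p\<close> be the first column with an \<open>i\<close> in the
  upper row.  In the columns from \<open>p\<close> to \<open>j\<close> the upper row consists of
  \<open>i\<close> and the lower row, which is present there and read first, of \<open>i +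
  1\<close>.  From \<open>(k + 1, p)\<close> up to the box before \<open>(k, j)\<close> the
  reading word thus has more openings than closings, and the bracket at \<open>(k, j)\<close> is
  matched.
\<close>
lemma crystal_reflection_column_closer:
  assumes "skew_shape lam mu" "T \<in> SSYT lam mu n"
    and "(k, j) \<in> boxes lam mu" "(Suc k, j) \<in> boxes lam mu"
    and "T (k, j) = i" "T (Suc k, j) = Suc i"
  shows "crystal_reflection lam mu i T (k, j) = i"
proof -
  note box = boxes_iff[of _ _ lam mu]
  have mu: "part mu (Suc k) \<le> part mu k"
    using assms(1) by (auto simp: skew_shape_def part_Suc_le)
  have L: "Suc k < length lam"
    using assms(4) by (auto simp: box part_def split: if_splits)
  define p where "p = (LEAST l. part mu k \<le> l \<and> T (k, l) = i)"
  have p: "part mu k \<le> p" "T (k, p) = i" "p \<le> j"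
    unfolding p_def using LeastI[of "\<lambda>l. part mu k \<le> l \<and> T (k, l) = i" j]
      Least_le[of "\<lambda>l. part mu k \<le> l \<and> T (k, l) = i" j] assms(3,5) by (auto simp: box)
  have p_least: "T (k, l) \<noteq> i" if "part mu k \<le> l" "l < p" for l
    using not_less_Least[of l "\<lambda>l. part mu k \<le> l \<and> T (k, l) = i"] that unfolding p_def by blast
  have up: "T (k, l) = i" if "p \<le> l" "l < j" for l
  proof (rule antisym)
    show "T (k, l) \<le> i"
      using SSYT_row_le[OF assms(2), of k l j] assms(3,5) that p by (simp add: box)
    show "i \<le> T (k, l)"
      using SSYT_row_le[OF assms(2), of k p l] assms(3) that p by (simp add: box)
  qed
  have down: "T (Suc k, l) = Suc i" if "p \<le> l" "l < j" for l
  proof (rule antisym)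
    show "T (Suc k, l) \<le> Suc i"
      using SSYT_row_le[OF assms(2), of "Suc k" l j] assms(4,6) that p mu by (simp add: box)
    show "Suc i \<le> T (Suc k, l)"
      using SSYT_column_less[OF assms(2), of k l "Suc k"] assms(3,4) that p mu up by (simp add: box)
  qed
  have right: "T (Suc k, l) \<noteq> i" if "Suc j \<le> l" "l < part lam (Suc k)" for l
    using SSYT_row_le[OF assms(2), of "Suc k" j l] assms(4,6) that by (simp add: box)
  obtain P Q where ro: "reading_order lam mu =
    P @ map (Pair (Suc k)) [part mu (Suc k)..<part lam (Suc k)]
      @ map (Pair k) [part mu k..<part lam k] @ Q"
    by (rule reading_order_two_rows[OF L])
  have s1: "[part mu (Suc k)..<part lam (Suc k)]
      = [part mu (Suc k)..<p] @ [p..<j] @ j # [Suc j..<part lam (Suc k)]"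
    using p mu assms(4) upt_split[of "part mu (Suc k)" p "part lam (Suc k)"]
      upt_split[of p j "part lam (Suc k)"] by (simp add: box upt_conv_Cons)
  have s2: "[part mu k..<part lam k] = [part mu k..<p] @ [p..<j] @ j # [Suc j..<part lam k]"
    using p assms(3) upt_split[of "part mu k" p "part lam k"]
      upt_split[of p j "part lam k"] by (simp add: box upt_conv_Cons)
  define A where "A = P @ map (Pair (Suc k)) [part mu (Suc k)..<p]"
  define V where "V = map (Pair (Suc k)) ([p..<j] @ j # [Suc j..<part lam (Suc k)])
    @ map (Pair k) ([part mu k..<p] @ [p..<j])"
  define B where "B = map (Pair k) [Suc j..<part lam k] @ Q"
  have split: "reading_order lam mu = (A @ V) @ (k, j) # B"
    unfolding ro s1 s2 A_def V_def B_def by simp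
  have "count_list (map T V) i = j - p"
  proof -
    have "count_list (map (T \<circ> Pair (Suc k)) [p..<j]) i = 0"
      by (rule count_list_map_avoid) (simp add: down)
    moreover have "count_list (map (T \<circ> Pair (Suc k)) [Suc j..<part lam (Suc k)]) i = 0"
      by (rule count_list_map_avoid) (simp add: right)
    moreover have "count_list (map (T \<circ> Pair k) [part mu k..<p]) i = 0"
      by (rule count_list_map_avoid) (simp add: p_least)
    moreover have "count_list (map (T \<circ> Pair k) [p..<j]) i = j - p"
      by (subst count_list_map_const) (simp_all add: up)
    ultimately show ?thesis by (simp add: V_def assms(6))
  qed
  moreover have "count_list (map T V) (Suc i) \<ge> Suc (j - p)"
  proof -
    have "count_list (map (T \<circ> Pair (Suc k)) [p..<j]) (Suc i) = j - p"
      by (subst count_list_map_const) (simp_all add: down)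
    then show ?thesis by (simp add: V_def assms(6))
  qed
  ultimately have "count_list (map T V) i < count_list (map T V) (Suc i)" by simp
  from reflect_keeps_closer[OF this, of "map T A" "map T B"] show ?thesis
    using crystal_reflection_nth[OF split, of i T] assms(5) by (simp add: split)
qed

text \<open>
  The same argument from the other side: with \<open>q\<close> the last column with \<open>i +
  1\<close> in the lower row, the reading word has more closings than openings from the box after
  \<open>(k + 1, j)\<close> up to \<open>(k, q)\<close>.
\<close>
lemma crystal_reflection_column_opener:
  assumes "skew_shape lam mu" "T \<in> SSYT lam mu n"
    and "(k, j) \<in> boxes lam mu" "(Suc k, j) \<in> boxes lam mu"
    and "T (k, j) = i" "T (Suc k, j) = Suc i"
  shows "crystal_reflection lam mu i T (Suc k, j) = Suc i"
proof -
  note box = boxes_iff[of _ _ lam mu]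
  have lam: "part lam (Suc k) \<le> part lam k" and mu: "part mu (Suc k) \<le> part mu k"
    using assms(1) by (auto simp: skew_shape_def part_Suc_le)
  have L: "Suc k < length lam"
    using assms(4) by (auto simp: box part_def split: if_splits)
  let ?R = "\<lambda>l. l < part lam (Suc k) \<and> T (Suc k, l) = Suc i"
  define q where "q = (GREATEST l. ?R l)"
  have j: "?R j" using assms(4,6) by (simp add: box)
  have bound: "\<And>l. ?R l \<Longrightarrow> l \<le> part lam (Suc k)" by simp
  have q: "q < part lam (Suc k)" "T (Suc k, q) = Suc i" "j \<le> q"
    using GreatestI_nat[of ?R, OF j bound] Greatest_le_nat[of ?R, OF j bound]
    unfolding q_def by blast+
  have q_greatest: "T (Suc k, l) \<noteq> Suc i" if "q < l" "l < part lam (Suc k)" for l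
    using Greatest_le_nat[of ?R l, OF _ bound] that unfolding q_def by fastforce
  have down: "T (Suc k, l) = Suc i" if "j \<le> l" "l \<le> q" for l
  proof (rule antisym)
    show "T (Suc k, l) \<le> Suc i"
      using SSYT_row_le[OF assms(2), of "Suc k" l q] assms(4) that q by (simp add: box)
    show "Suc i \<le> T (Suc k, l)"
      using SSYT_row_le[OF assms(2), of "Suc k" j l] assms(4,6) that q by (simp add: box)
  qed
  have up: "T (k, l) = i" if "j \<le> l" "l \<le> q" for l
  proof (rule antisym)
    show "i \<le> T (k, l)"
      using SSYT_row_le[OF assms(2), of k j l] assms(3,5) that q lam by (simp add: box)
    have "T (k, l) < T (Suc k, l)"
      using SSYT_column_less[OF assms(2), of k l "Suc k"] assms(3,4) that q lam by (simp add: box)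
    then show "T (k, l) \<le> i" using down[OF that] by simp
  qed
  have left: "T (k, l) \<noteq> Suc i" if "part mu k \<le> l" "l < j" for l
    using SSYT_row_le[OF assms(2), of k l j] assms(3,5) that by (simp add: box)
  obtain P Q where ro: "reading_order lam mu =
    P @ map (Pair (Suc k)) [part mu (Suc k)..<part lam (Suc k)]
      @ map (Pair k) [part mu k..<part lam k] @ Q"
    by (rule reading_order_two_rows[OF L])
  have s1: "[part mu (Suc k)..<part lam (Suc k)]
      = [part mu (Suc k)..<j] @ j # [Suc j..<Suc q] @ [Suc q..<part lam (Suc k)]"
    using q assms(4) upt_split[of "part mu (Suc k)" j "part lam (Suc k)"]
      upt_split[of "Suc j" "Suc q" "part lam (Suc k)"] by (simp add: box upt_conv_Cons del: upt_Suc)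
  have s2: "[part mu k..<part lam k] = [part mu k..<j] @ [j..<Suc q] @ [Suc q..<part lam k]"
    using q lam assms(3) upt_split[of "part mu k" j "part lam k"]
      upt_split[of j "Suc q" "part lam k"] by (simp add: box del: upt_Suc)
  define A where "A = P @ map (Pair (Suc k)) [part mu (Suc k)..<j]"
  define V where "V = map (Pair (Suc k)) ([Suc j..<Suc q] @ [Suc q..<part lam (Suc k)])
    @ map (Pair k) ([part mu k..<j] @ [j..<Suc q])"
  define B where "B = map (Pair k) [Suc q..<part lam k] @ Q"
  have split: "reading_order lam mu = A @ (Suc k, j) # V @ B"
    unfolding ro s1 s2 A_def V_def B_def by simp
  have "count_list (map T V) (Suc i) = q - j"
  proof -
    have "count_list (map (T \<circ> Pair (Suc k)) [Suc j..<Suc q]) (Suc i) = q - j"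
      by (subst count_list_map_const) (simp_all add: down del: upt_Suc)
    moreover have "count_list (map (T \<circ> Pair (Suc k)) [Suc q..<part lam (Suc k)]) (Suc i) = 0"
      by (rule count_list_map_avoid) (simp add: q_greatest)
    moreover have "count_list (map (T \<circ> Pair k) [part mu k..<j]) (Suc i) = 0"
      by (rule count_list_map_avoid) (simp add: left)
    moreover have "count_list (map (T \<circ> Pair k) [j..<Suc q]) (Suc i) = 0"
      by (rule count_list_map_avoid) (simp add: up del: upt_Suc)
    ultimately show ?thesis by (simp add: V_def del: upt_Suc)
  qed
  moreover have "count_list (map T V) i \<ge> Suc (q - j)"
  proof -
    have "count_list (map (T \<circ> Pair k) [j..<Suc q]) i = Suc (q - j)"
      using q(3) by (subst count_list_map_const) (simp_all add: up Suc_diff_le del: upt_Suc)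
    then show ?thesis by (simp add: V_def del: upt_Suc)
  qed
  ultimately have "count_list (map T V) (Suc i) < count_list (map T V) i" by simp
  from reflect_keeps_opener[OF this, of "map T A" "map T B"] show ?thesis
    using crystal_reflection_nth[OF split, of i T] assms(6) by (simp add: split)
qed

text \<open>
  Neighbours in a row are neighbours in the reading word, so \<open>reflect_nondescent\<close>
  applies.
\<close>
lemma crystal_reflection_row:
  assumes "(k, j) \<in> boxes lam mu" "(k, Suc j) \<in> boxes lam mu" "T (k, j) \<le> T (k, Suc j)"
  shows "crystal_reflection lam mu i T (k, j) \<le> crystal_reflection lam mu i T (k, Suc j)"
proof -
  note box = boxes_iff[of _ _ lam mu]
  have "k < length lam"
    using assms(1) by (auto simp: box part_def split: if_splits)
  then obtain P Q where ro: "reading_order lam mu = P @ map (Pair k) [part mu k..<part lam k] @ Q"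
    by (rule reading_order_row)
  have "[part mu k..<part lam k] = [part mu k..<j] @ j # Suc j # [Suc (Suc j)..<part lam k]"
    using assms(1,2) upt_split[of "part mu k" j "part lam k"] by (simp add: box upt_conv_Cons)
  then have 1: "reading_order lam mu = (P @ map (Pair k) [part mu k..<j]) @ (k, j) # (k, Suc j)
      # (map (Pair k) [Suc (Suc j)..<part lam k] @ Q)" (is "_ = ?A @ _ # _ # ?B")
    by (simp add: ro)
  then have 2: "reading_order lam mu = (?A @ [(k, j)]) @ (k, Suc j) # ?B" by simp
  have "reflect i (map T (reading_order lam mu)) ! length ?A
      \<le> reflect i (map T (reading_order lam mu)) ! Suc (length ?A)"
    by (rule reflect_nondescent) (use assms(3) in \<open>simp_all add: 1 nth_append\<close>)
  then show ?thesis
    using crystal_reflection_nth[OF 1, of i T] crystal_reflection_nth[OF 2, of i T] by simp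
qed

lemma crystal_reflection_values:
  "crystal_reflection lam mu i T c = T c \<or>
    T c = i \<and> crystal_reflection lam mu i T c = Suc i \<or>
    T c = Suc i \<and> crystal_reflection lam mu i T c = i"
proof -
  obtain cl op where u: "unmatched T i (reading_order lam mu) = (cl, op)" by fastforce
  have "T c = i" if "c \<in> set cl"
    using set_unmatched_aux(1)[of T i "reading_order lam mu" "[]" "[]" cl op] u that
    by (auto simp: unmatched_def)
  moreover have "T c = Suc i" if "c \<in> set op"
    using set_unmatched_aux(2)[of T i "reading_order lam mu" "[]" "[]" cl op] u that
    by (auto simp: unmatched_def)
  ultimately have *: "T c = i \<or> T c = Suc i" if "c \<in> set (cl @ op)"
    using that by auto
  define us where "us = cl @ op"
  have "crystal_reflection lam mu i T c = (if c \<in> set (take (length op) us) then i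
      else if c \<in> set (drop (length op) us) then Suc i else T c)"
    by (simp add: crystal_reflection_def u us_def Let_def)
  then show ?thesis
    using * in_set_takeD[of c "length op" us] in_set_dropD[of c "length op" us]
    unfolding us_def[symmetric] by (auto split: if_splits)
qed

lemma crystal_reflection_column:
  assumes "skew_shape lam mu" "T \<in> SSYT lam mu n"
    and "(k, j) \<in> boxes lam mu" "(Suc k, j) \<in> boxes lam mu"
  shows "crystal_reflection lam mu i T (k, j) < crystal_reflection lam mu i T (Suc k, j)"
proof (cases "T (k, j) = i \<and> T (Suc k, j) = Suc i")
  case True
  then show ?thesis
    using crystal_reflection_column_closer[OF assms] crystal_reflection_column_opener[OF assms]
    by simp
next
  case False
  have "T (k, j) < T (Suc k, j)"
    using SSYT_column_less[OF assms(2-4)] by simp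
  then show ?thesis
    using False crystal_reflection_values[of lam mu i T "(k, j)"]
      crystal_reflection_values[of lam mu i T "(Suc k, j)"]
    by linarith
qed

text \<open>
  Since rows and columns of a skew shape have no gaps, comparing adjacent boxes suffices.
\<close>
lemma SSYT_I:
  assumes "skew_shape lam mu" "T \<in> boxes lam mu \<rightarrow>\<^sub>E {1..n}"
    and row: "\<And>k j. (k, j) \<in> boxes lam mu \<Longrightarrow> (k, Suc j) \<in> boxes lam mu
      \<Longrightarrow> T (k, j) \<le> T (k, Suc j)"
    and column: "\<And>k j. (k, j) \<in> boxes lam mu \<Longrightarrow> (Suc k, j) \<in> boxes lam mu
      \<Longrightarrow> T (k, j) < T (Suc k, j)"
  shows "T \<in> SSYT lam mu n"
proof -
  have rows: "T (k, j) \<le> T (k, j')"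
    if "(k, j) \<in> boxes lam mu" "(k, j') \<in> boxes lam mu" "j < j'" for k j j'
    using that(3,2)
  proof (induction j')
    case (Suc j')
    show ?case
    proof (cases "j = j'")
      case True
      then show ?thesis using row that(1) Suc.prems(2) by simp
    next
      case False
      then have "j < j'" "(k, j') \<in> boxes lam mu"
        using Suc.prems that(1) by (auto simp: boxes_iff)
      then show ?thesis
        using Suc.IH row[OF _ Suc.prems(2)] by (meson order_trans)
    qed
  qed simp
  have columns: "T (k, j) < T (k', j)"
    if "(k, j) \<in> boxes lam mu" "(k', j) \<in> boxes lam mu" "k < k'" for k k' j
    using that(3,2)
  proof (induction k')
    case (Suc k')
    show ?case
    proof (cases "k = k'")
      case True
      then show ?thesis using column that(1) Suc.prems(2) by simp
    next
      case False
      then have "k < k'" using Suc.prems by simp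
      moreover have "(k', j) \<in> boxes lam mu"
        using Suc.prems(2) that(1) \<open>k < k'\<close> assms(1) part_antimono[of mu k k']
          part_antimono[of lam k' "Suc k'"] by (auto simp: boxes_iff skew_shape_def)
      ultimately show ?thesis
        using Suc.IH column[OF _ Suc.prems(2)] by (meson less_trans)
    qed
  qed simp
  show ?thesis
    using assms(2) rows columns by (simp add: SSYT_def)
qed

lemma crystal_reflection_SSYT:
  assumes "skew_shape lam mu" "T \<in> SSYT lam mu n" "1 \<le> i" "i < n"
  shows "crystal_reflection lam mu i T \<in> SSYT lam mu n"
proof (rule SSYT_I)
  have T: "T \<in> boxes lam mu \<rightarrow>\<^sub>E {1..n}"
    using assms(2) by (simp add: SSYT_def)
  show "crystal_reflection lam mu i T \<in> boxes lam mu \<rightarrow>\<^sub>E {1..n}"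
  proof (rule PiE_I)
    fix c assume "c \<in> boxes lam mu"
    then have "T c \<in> {1..n}" using T by blast
    then show "crystal_reflection lam mu i T c \<in> {1..n}"
      using assms(3,4) crystal_reflection_values[of lam mu i T c]
      unfolding atLeastAtMost_iff by linarith
  next
    fix c assume "c \<notin> boxes lam mu"
    then show "crystal_reflection lam mu i T c = undefined"
      using PiE_arb[OF T] by (simp add: crystal_reflection_outside)
  qed
  show "crystal_reflection lam mu i T (k, j) \<le> crystal_reflection lam mu i T (k, Suc j)"
    if "(k, j) \<in> boxes lam mu" "(k, Suc j) \<in> boxes lam mu" for k j
    using that SSYT_row_le[OF assms(2), of k j "Suc j"] by (intro crystal_reflection_row) auto
  show "crystal_reflection lam mu i T (k, j) < crystal_reflection lam mu i T (Suc k, j)"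
    if "(k, j) \<in> boxes lam mu" "(Suc k, j) \<in> boxes lam mu" for k j
    using that assms by (intro crystal_reflection_column)
qed (rule assms(1))

lemma crystal_cycle_SSYT:
  assumes "skew_shape lam mu" "T \<in> SSYT lam mu n"
  shows "crystal_cycle lam mu n T \<in> SSYT lam mu n"
proof -
  have "fold (crystal_reflection lam mu) js S \<in> SSYT lam mu n"
    if "set js \<subseteq> {1..<n}" "S \<in> SSYT lam mu n" for js S
    using that
  proof (induction js arbitrary: S)
    case (Cons i js)
    then have "crystal_reflection lam mu i S \<in> SSYT lam mu n"
      by (intro crystal_reflection_SSYT assms(1)) auto
    then show ?case using Cons by simp
  qed simp
  then show ?thesis
    using assms(2) by (simp add: crystal_cycle_def)
qed

section \<open>The cyclic group and its action\<close>

lemma n_cycle_eq: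
  "n_cycle n j = (if 1 < j \<and> j \<le> n then j - 1 else if j = 1 \<and> 1 \<le> n then n else j)"
proof (induction n arbitrary: j)
  case 0
  then show ?case by (simp add: n_cycle_def)
next
  case (Suc m)
  show ?case
  proof (cases "m = 0")
    case True
    then show ?thesis by (simp add: n_cycle_def)
  next
    case False
    then have "n_cycle (Suc m) j = transpose m (Suc m) (n_cycle m j)"
      by (simp add: n_cycle_def)
    then show ?thesis
      using False unfolding Suc.IH by (auto simp: transpose_def)
  qed
qed

text \<open>
  On letters the cycle is inverse to \<^const>\<open>shift\<close>, from which it inherits its
  order.
\<close>
lemma n_cycle_shift: "n_cycle n (shift n j) = j" and shift_n_cycle: "shift n (n_cycle n j) = j"
  by (auto simp: n_cycle_eq shift_def)

lemma funpow_left_inverse: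
  fixes f g :: "'a \<Rightarrow> 'a"
  assumes "\<And>x. f (g x) = x"
  shows "(f ^^ k) ((g ^^ k) x) = x"
proof (induction k arbitrary: x)
  case (Suc k)
  then show ?case
    by (simp only: funpow.simps comp_apply funpow_swap1[of g] assms)
qed simp

lemma n_cycle_funpow_eq_id_iff:
  assumes "n \<ge> 1"
  shows "n_cycle n ^^ k = id \<longleftrightarrow> n dvd k"
proof -
  have "n_cycle n ^^ k = id \<longleftrightarrow> shift n ^^ k = id"
    using funpow_left_inverse[of "n_cycle n" "shift n" k, OF n_cycle_shift]
      funpow_left_inverse[of "shift n" "n_cycle n" k, OF shift_n_cycle]
    by (metis eq_id_iff)
  then show ?thesis using shift_funpow_eq_id_iff[OF assms] by simp
qed

lemma n_cycle_permutes: "n_cycle n permutes {1..n}"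
proof -
  have "bij (n_cycle n)"
    by (rule o_bij[of "shift n"]) (simp_all add: fun_eq_iff n_cycle_shift shift_n_cycle)
  then show ?thesis
    by (auto simp: permutes_def bij_iff n_cycle_eq)
qed

lemma sym_group_pow: "f [^]\<^bsub>sym_group n\<^esub> (k :: nat) = f ^^ k"
proof (induction k)
  case (Suc k)
  then show ?case
    by (simp add: sym_group_mult funpow_Suc_right del: funpow.simps)
qed (simp add: sym_group_one)

lemma ord_n_cycle:
  assumes "n \<ge> 1"
  shows "group.ord (sym_group n) (n_cycle n) = n"
  using n_cycle_funpow_eq_id_iff[OF assms] n_cycle_permutes
  by (simp add: group.ord_unique[OF sym_group_is_group] sym_group_carrier sym_group_pow sym_group_one)

lemma n_cycle_funpow_eq_iff:
  assumes "n \<ge> 1"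
  shows "n_cycle n ^^ a = n_cycle n ^^ b \<longleftrightarrow> a mod n = b mod n"
proof -
  have "n_cycle n ^^ a = n_cycle n ^^ b \<longleftrightarrow> int n dvd (int b - int a)"
    using group.int_pow_eq[OF sym_group_is_group, of "n_cycle n" n "int a" "int b"] n_cycle_permutes
    by (simp add: sym_group_carrier int_pow_int sym_group_pow ord_n_cycle[OF assms])
  also have "\<dots> \<longleftrightarrow> a mod n = b mod n"
    by (metis mod_eq_dvd_iff of_nat_eq_iff of_nat_mod)
  finally show ?thesis .
qed

lemma carrier_cycle_group:
  assumes "n \<ge> 1"
  shows "carrier (cycle_group n) = range (\<lambda>k :: nat. n_cycle n ^^ k)"
proof -
  interpret group "sym_group n" by (rule sym_group_is_group)
  have a: "n_cycle n \<in> carrier (sym_group n)"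
    using n_cycle_permutes by (simp add: sym_group_carrier)
  have "n_cycle n [^]\<^bsub>sym_group n\<^esub> (i :: int) = n_cycle n ^^ (nat (i mod int n))" for i
  proof -
    have "n_cycle n [^]\<^bsub>sym_group n\<^esub> i = n_cycle n [^]\<^bsub>sym_group n\<^esub> (i mod int n)"
      by (simp add: int_pow_eq[OF a] ord_n_cycle[OF assms] minus_mod_eq_mult_div dvd_minus_mod
          flip: dvd_minus_iff[of "int n" "i mod int n - i"])
    also have "i mod int n = int (nat (i mod int n))" using assms by simp
    finally show ?thesis by (simp only: int_pow_int sym_group_pow)
  qed
  then have "range (\<lambda>i :: int. n_cycle n [^]\<^bsub>sym_group n\<^esub> i) \<subseteq> range (\<lambda>k :: nat. n_cycle n ^^ k)"
    by auto
  moreover have "n_cycle n ^^ k = n_cycle n [^]\<^bsub>sym_group n\<^esub> (int k)" for k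
    by (simp only: int_pow_int sym_group_pow)
  ultimately show ?thesis
    unfolding cycle_group_def carrier_subgroup_generated_by_singleton[OF a] by auto
qed

lemma group_cycle_group: "group (cycle_group n)"
  by (simp add: cycle_group_def group.group_subgroup_generated[OF sym_group_is_group])

lemma card_cycle_group:
  assumes "n \<ge> 1"
  shows "card (carrier (cycle_group n)) = n" and "finite (carrier (cycle_group n))"
proof -
  interpret group "sym_group n" by (rule sym_group_is_group)
  have a: "n_cycle n \<in> carrier (sym_group n)"
    using n_cycle_permutes by (simp add: sym_group_carrier)
  then have C: "carrier (cycle_group n) = generate (sym_group n) {n_cycle n}"
    by (simp add: cycle_group_def carrier_subgroup_generated)
  then show card: "card (carrier (cycle_group n)) = n"
    using generate_pow_card[OF a] ord_n_cycle[OF assms] by simp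
  show "finite (carrier (cycle_group n))"
    using card assms by (intro card_ge_0_finite) simp
qed

text \<open>
  The choice of the exponent is immaterial: exponents with the same power of the cycle are
  congruent modulo \<open>n\<close>, and the crystal cycle has order dividing \<open>n\<close>.
\<close>
lemma cycle_action_funpow:
  assumes "n \<ge> 1"
  shows "cycle_action lam mu n X (n_cycle n ^^ k) = restrict (crystal_cycle lam mu n ^^ k) X"
proof -
  define l where "l = (LEAST l. n_cycle n ^^ l = n_cycle n ^^ k)"
  have "n_cycle n ^^ l = n_cycle n ^^ k"
    unfolding l_def by (rule LeastI[of _ k]) simp
  then have "l mod n = k mod n"
    using n_cycle_funpow_eq_iff[OF assms] by blast
  moreover have "(crystal_cycle lam mu n ^^ j) T = (crystal_cycle lam mu n ^^ (j mod n)) T" for j T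
    by (rule funpow_mod_eq[symmetric]) (rule crystal_cycle_funpow_n)
  ultimately have "crystal_cycle lam mu n ^^ l = crystal_cycle lam mu n ^^ k"
    by (metis ext)
  then show ?thesis by (simp add: cycle_action_def l_def)
qed

lemma group_action_cycle_action:
  assumes "n \<ge> 1" and closed: "\<And>T. T \<in> X \<Longrightarrow> crystal_cycle lam mu n T \<in> X"
  shows "group_action (cycle_group n) X (cycle_action lam mu n X)"
proof -
  let ?c = "crystal_cycle lam mu n"
  have power: "(?c ^^ k) T \<in> X" if "T \<in> X" for k T
    using that closed by (induction k) auto
  have "restrict (?c ^^ k) X \<in> Bij X" for k
  proof -
    have "bij_betw (?c ^^ k) X X"
    proof (rule bij_betw_byWitness[where f' = "?c ^^ (k * (n - 1))"])
      have "(?c ^^ (k * n)) T = T" for T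
        using funpow_mod_eq[where f = ?c and n = n and x = T and m = "k * n"] crystal_cycle_funpow_n by simp
      moreover have "k * (n - 1) + k = k * n" "k + k * (n - 1) = k * n"
        using assms(1) by (simp_all add: algebra_simps)
      ultimately show "\<forall>T\<in>X. (?c ^^ (k * (n - 1))) ((?c ^^ k) T) = T"
        and "\<forall>T\<in>X. (?c ^^ k) ((?c ^^ (k * (n - 1))) T) = T"
        by (metis comp_apply funpow_add)+
    qed (use power in auto)
    then show ?thesis
      by (simp add: Bij_def bij_betw_restrict_eq)
  qed
  then have bij: "cycle_action lam mu n X \<sigma> \<in> Bij X" if "\<sigma> \<in> carrier (cycle_group n)" for \<sigma>
    using that by (auto simp: carrier_cycle_group[OF assms(1)] cycle_action_funpow[OF assms(1)])
  have mult: "cycle_action lam mu n X (\<sigma> \<otimes>\<^bsub>cycle_group n\<^esub> \<tau>)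
      = compose X (cycle_action lam mu n X \<sigma>) (cycle_action lam mu n X \<tau>)"
    if \<sigma>\<tau>: "\<sigma> \<in> carrier (cycle_group n)" "\<tau> \<in> carrier (cycle_group n)" for \<sigma> \<tau>
  proof -
    obtain k l where kl: "\<sigma> = n_cycle n ^^ k" "\<tau> = n_cycle n ^^ l"
      using \<sigma>\<tau> unfolding carrier_cycle_group[OF assms(1)] by blast
    then have "\<sigma> \<otimes>\<^bsub>cycle_group n\<^esub> \<tau> = n_cycle n ^^ (k + l)"
      by (simp add: cycle_group_def sym_group_mult funpow_add)
    then have "cycle_action lam mu n X (\<sigma> \<otimes>\<^bsub>cycle_group n\<^esub> \<tau>) = restrict (?c ^^ (k + l)) X"
      by (simp only: cycle_action_funpow[OF assms(1)])
    also have "\<dots> = compose X (restrict (?c ^^ k) X) (restrict (?c ^^ l) X)"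
      using power by (intro ext) (simp add: compose_def funpow_add)
    finally show ?thesis
      by (simp only: kl cycle_action_funpow[OF assms(1)])
  qed
  show ?thesis
    by (intro group_action.intro group_hom.intro group_hom_axioms.intro homI group_cycle_group
        group_BijGroup) (simp_all add: BijGroup_def bij mult)
qed

section \<open>Cyclic sieving from a statistic that drifts\<close>

text \<open>
  If every step of \<open>c\<close> lowers the statistic by \<open>m\<close> modulo
  \<open>n\<close>, then \<open>k\<close> steps lower it by \<open>k m\<close>, and
  \<open>m\<close> is invertible modulo \<open>n\<close>; so the old value can recur only if
  \<open>n\<close> divides \<open>k\<close>.
\<close>
lemma dvd_return_time:
  fixes stat :: "'a \<Rightarrow> nat"
  assumes closed: "\<And>T. T \<in> X \<Longrightarrow> c T \<in> X"
    and stat: "\<And>T. T \<in> X \<Longrightarrow> (stat (c T) + m) mod n = stat T mod n"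
    and "gcd m n = 1" "T \<in> X" "stat ((c ^^ k) T) = stat T"
  shows "n dvd k"
proof -
  have "(c ^^ k) T \<in> X \<and> (stat ((c ^^ k) T) + k * m) mod n = stat T mod n" for k
  proof (induction k)
    case (Suc k)
    have "(stat ((c ^^ Suc k) T) + Suc k * m) mod n = (stat (c ((c ^^ k) T)) + m + k * m) mod n"
      by (simp add: algebra_simps)
    also have "\<dots> = (stat ((c ^^ k) T) + k * m) mod n"
      using stat[of "(c ^^ k) T"] Suc by (metis mod_add_left_eq)
    finally show ?case using Suc closed by simp
  qed (use assms(4) in simp)
  then have "(stat T + k * m) mod n = stat T mod n"
    using assms(5) by metis
  then have "n dvd k * m"
    by (metis add_diff_cancel_left' le_add1 mod_eq_dvd_iff_nat)
  then show ?thesis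
    using assms(3) by (simp add: coprime_dvd_mult_left_iff coprime_iff_gcd_eq_1 gcd.commute)
qed

text \<open>
  Such a drifting statistic is all that cyclic sieving needs.  A power of the generator that is
  not the identity fixes nothing by \<open>dvd_return_time\<close>, and the polynomial vanishes at
  every \<open>n\<close>th root of unity \<open>\<zeta> \<noteq> 1\<close>, because reindexing
  along \<open>c\<close> shows that its value does not change when multiplied by
  \<open>\<zeta>\<^sup>m \<noteq> 1\<close>.
\<close>
lemma cycle_action_exhibits_CSP:
  fixes stat :: "tableau \<Rightarrow> nat"
  assumes "n \<ge> 1" "finite X" and coprime: "gcd m n = 1"
    and closed: "\<And>T. T \<in> X \<Longrightarrow> crystal_cycle lam mu n T \<in> X"
    and stat: "\<And>T. T \<in> X \<Longrightarrow> (stat (crystal_cycle lam mu n T) + m) mod n = stat T mod n"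
  shows "exhibits_CSP X (cycle_group n) (cycle_action lam mu n X) (\<Sum>T\<in>X. monom 1 (stat T))"
proof -
  let ?c = "crystal_cycle lam mu n" and ?C = "cycle_group n"
  have fixed: "n dvd k" if "T \<in> X" "(?c ^^ k) T = T" for k T
    using that(2) by (intro dvd_return_time[of X ?c stat, OF closed stat coprime that(1)]) simp_all
  have bij: "bij_betw ?c X X"
  proof -
    have "?c \<in> X \<rightarrow> X" using closed by blast
    moreover have "inj_on ?c X"
    proof (rule inj_onI)
      fix S T assume "?c S = ?c T"
      then have "(?c ^^ (n - 1)) (?c S) = (?c ^^ (n - 1)) (?c T)" by simp
      then have "(?c ^^ n) S = (?c ^^ n) T"
        using assms(1) by (cases n) (simp_all add: funpow_swap1)
      then show "S = T" by (simp add: crystal_cycle_funpow_n)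
    qed
    ultimately show ?thesis
      using assms(2) by (metis bij_betw_def endo_inj_surj image_subset_iff_funcset)
  qed
  have vanish: "(\<Sum>T\<in>X. \<zeta> ^ stat T) = 0" if "\<zeta> ^ n = 1" "\<zeta> \<noteq> 1" for \<zeta> :: complex
  proof -
    have pow_mod: "\<zeta> ^ a = \<zeta> ^ (a mod n)" for a
    proof -
      have "\<zeta> ^ a = \<zeta> ^ (n * (a div n) + a mod n)" by simp
      also have "\<dots> = \<zeta> ^ (a mod n)"
        by (simp only: power_add power_mult that(1) power_one mult_1)
      finally show ?thesis .
    qed
    \<comment> \<open>The factor \<open>\<zeta>\<^sup>m\<close> makes up for the drop of the exponent along \<open>c\<close>.\<close>
    have "\<zeta> ^ m * (\<Sum>T\<in>X. \<zeta> ^ stat T) = \<zeta> ^ m * (\<Sum>T\<in>X. \<zeta> ^ stat (?c T))"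
      using sum.reindex_bij_betw[OF bij, of "\<lambda>T. \<zeta> ^ stat T"] by simp
    also have "\<dots> = (\<Sum>T\<in>X. \<zeta> ^ (stat (?c T) + m))"
      by (simp add: sum_distrib_left power_add mult.commute)
    also have "\<dots> = (\<Sum>T\<in>X. \<zeta> ^ stat T)"
      by (rule sum.cong) (use stat pow_mod in metis)+
    finally have "(\<zeta> ^ m - 1) * (\<Sum>T\<in>X. \<zeta> ^ stat T) = 0"
      by (simp add: algebra_simps)
    moreover have "\<zeta> ^ m \<noteq> 1"
    proof
      assume m: "\<zeta> ^ m = 1"
      have "n \<noteq> 0" using assms(1) by simp
      then obtain x y where "n * x = m * y + gcd n m" using bezout_nat by blast
      then have "n * x = m * y + 1" using coprime by (simp add: gcd.commute)
      then have "\<zeta> ^ (n * x) = \<zeta> ^ (m * y + 1)" by simp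
      then show False using m that by (simp add: power_mult power_add)
    qed
    ultimately show ?thesis by simp
  qed
  have poly: "poly (\<Sum>T\<in>X. monom 1 (stat T)) \<zeta> = (\<Sum>T\<in>X. \<zeta> ^ stat T)" for \<zeta> :: complex
    by (simp add: poly_sum poly_monom)
  have "of_nat (card {T \<in> X. cycle_action lam mu n X (g [^]\<^bsub>?C\<^esub> k) T = T})
      = poly (\<Sum>T\<in>X. monom 1 (stat T)) (\<xi> powi k)"
    if g: "g \<in> carrier ?C" "generate ?C {g} = carrier ?C"
      and xi: "primitive_root_of_unity (card (carrier ?C)) \<xi>" for g \<xi> and k :: int
  proof -
    interpret C: group ?C by (rule group_cycle_group)
    have "C.ord g = n"
      using C.generate_pow_card[OF g(1)] g(2) card_cycle_group[OF assms(1)] by simp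
    then have g_one: "g [^]\<^bsub>?C\<^esub> k = \<one>\<^bsub>?C\<^esub> \<longleftrightarrow> int n dvd k"
      using C.int_pow_eq_id[OF g(1)] by simp
    have one: "\<one>\<^bsub>?C\<^esub> = n_cycle n ^^ 0"
      by (simp add: cycle_group_def sym_group_one)
    have root: "\<xi> ^ n = 1" "\<And>j. 1 \<le> j \<Longrightarrow> j < n \<Longrightarrow> \<xi> ^ j \<noteq> 1"
      using xi by (auto simp: primitive_root_of_unity_def card_cycle_group[OF assms(1)])
    then have "\<xi> \<noteq> 0" using assms(1) by (auto simp: power_0_left)
    have red: "\<xi> powi k = \<xi> ^ nat (k mod int n)"
    proof -
      have "\<xi> powi k = \<xi> powi (int n * (k div int n) + k mod int n)" by simp
      also have "\<dots> = (\<xi> powi int n) powi (k div int n) * \<xi> powi (k mod int n)"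
        using \<open>\<xi> \<noteq> 0\<close> by (subst power_int_add) (simp_all add: power_int_mult)
      also have "\<dots> = \<xi> ^ nat (k mod int n)"
        using root(1) assms(1) by (simp add: power_int_def)
      finally show ?thesis .
    qed
    show ?thesis
    proof (cases "int n dvd k")
      case True
      have "cycle_action lam mu n X (n_cycle n ^^ 0) T = T" if "T \<in> X" for T
        using that by (subst cycle_action_funpow[OF assms(1)]) simp
      then have "{T \<in> X. cycle_action lam mu n X (g [^]\<^bsub>?C\<^esub> k) T = T} = X"
        using g_one True one by auto
      then show ?thesis using True by (simp add: poly red)
    next
      case False
      obtain l where l: "g [^]\<^bsub>?C\<^esub> k = n_cycle n ^^ l"
        using C.int_pow_closed[OF g(1), of k] by (auto simp: carrier_cycle_group[OF assms(1)])
      have "\<not> n dvd l"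
        using False g_one one l n_cycle_funpow_eq_id_iff[OF assms(1)] by simp
      then have empty: "{T \<in> X. cycle_action lam mu n X (g [^]\<^bsub>?C\<^esub> k) T = T} = {}"
        using fixed by (auto simp: l cycle_action_funpow[OF assms(1)])
      have power_one: "(\<xi> powi k) ^ n = 1"
        by (simp add: red power_mult[symmetric] mult.commute[of _ n]) (simp add: power_mult root(1))
      have "\<xi> powi k \<noteq> 1"
      proof -
        have "0 < k mod int n" "k mod int n < int n"
          using False assms(1) by (simp_all add: dvd_eq_mod_eq_0 order_le_neq_trans)
        then show ?thesis unfolding red by (intro root(2)) linarith+
      qed
      from vanish[OF power_one this] show ?thesis
        by (simp only: empty poly card.empty of_nat_0)
    qed
  qed
  then show ?thesis
    using assms(2) card_cycle_group[OF assms(1)] group_action_cycle_action[OF assms(1) closed]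
      group.cyclic_group_generated[OF sym_group_is_group]
    unfolding exhibits_CSP_def by (auto simp: cycle_group_def)
qed

text \<open>
  Shifting lowers each index by one, which costs the total weight, except that index
  \<open>1\<close> moves up to \<open>n\<close>, which returns \<open>n w\<^sub>1\<close>.
\<close>
lemma sum_shift_weight:
  fixes w :: "nat \<Rightarrow> nat"
  assumes "n \<ge> 1"
  shows "(\<Sum>i=1..n. i * w (shift n i)) + (\<Sum>i=1..n. w i) = (\<Sum>i=1..n. i * w i) + n * w 1"
proof -
  obtain k where n: "n = Suc k" using assms by (cases n) auto
  have "(\<Sum>i=1..n. i * w (shift n i)) = (\<Sum>i=1..k. i * w (Suc i)) + n * w 1"
    by (simp add: n shift_def)
  moreover have "(\<Sum>i=1..n. w i) = w 1 + (\<Sum>i=1..k. w (Suc i))"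
    unfolding n by (subst sum.atLeast_Suc_atMost) (simp_all add: sum.shift_bounds_cl_Suc_ivl del: sum.cl_ivl_Suc)
  moreover have "(\<Sum>i=1..n. i * w i) = w 1 + (\<Sum>i=1..k. Suc i * w (Suc i))"
    unfolding n by (subst sum.atLeast_Suc_atMost) (simp_all add: sum.shift_bounds_cl_Suc_ivl del: sum.cl_ivl_Suc)
  ultimately show ?thesis by (simp add: sum.distrib)
qed

section \<open>The rotations of a content\<close>

lemma finite_boxes: "finite (boxes lam mu)"
  unfolding set_reading_order[symmetric] by simp

lemma finite_SSYT: "finite (SSYT lam mu n)"
  by (rule finite_subset[OF _ finite_PiE[OF finite_boxes, of lam mu "\<lambda>_. {1..n}"]])
    (auto simp: SSYT_def)

lemma crystal_cycle_SSYT_content: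
  assumes "skew_shape lam mu" "T \<in> SSYT_content lam mu \<beta>" "length \<beta> = n"
  shows "crystal_cycle lam mu n T \<in> SSYT_content lam mu (rotate 1 \<beta>)"
proof -
  have T: "T \<in> SSYT lam mu n" and w: "\<And>i. i \<in> {1..n} \<Longrightarrow> weight lam mu T i = \<beta> ! (i - 1)"
    using assms(2,3) by (auto simp: SSYT_content_def)
  have "weight lam mu (crystal_cycle lam mu n T) i = rotate 1 \<beta> ! (i - 1)" if "i \<in> {1..n}" for i
  proof -
    have "rotate 1 \<beta> ! (i - 1) = \<beta> ! (i mod n)"
      using that assms(3) by (subst nth_rotate) auto
    moreover have "shift n i - 1 = i mod n" "shift n i \<in> {1..n}"
      using that by (auto simp: shift_def)
    ultimately show ?thesis
      using w[of "shift n i"] by (simp add: weight_crystal_cycle)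
  qed
  then show ?thesis
    using crystal_cycle_SSYT[OF assms(1) T] assms(3) by (simp add: SSYT_content_def)
qed

theorem theorem6:
  fixes n m :: nat and lam mu \<alpha> :: "nat list" and X :: "tableau set"
  assumes "n \<ge> 1"
    and "skew_shape lam mu"
    and "m = skew_size lam mu"
    and "weak_composition \<alpha> m n"
    and "gcd m n = 1"
    and "X = (\<Union>r\<in>{1..n}. SSYT_content lam mu (rotate r \<alpha>))"
  shows "disjoint_family_on (\<lambda>r. SSYT_content lam mu (rotate r \<alpha>)) {1..n} \<and>
    exhibits_CSP X (cycle_group n) (cycle_action lam mu n X)
      (\<Sum>T\<in>X. monom 1 (\<Sum>i=1..n. i * weight lam mu T i))"
proof
  let ?c = "crystal_cycle lam mu n" and ?stat = "\<lambda>T. \<Sum>i=1..n. i * weight lam mu T i"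
  have length: "length (rotate r \<alpha>) = n" for r
    using assms(4) by (simp add: weak_composition_def)
  have "sum_list (rotate1 xs) = sum_list xs" for xs :: "nat list"
    by (cases xs) simp_all
  then have sum: "sum_list (rotate r \<alpha>) = m" for r
    using assms(4) by (induction r) (simp_all add: weak_composition_def)
  have content_weight: "weight lam mu T i = rotate r \<alpha> ! (i - 1)"
    if "T \<in> SSYT_content lam mu (rotate r \<alpha>)" "i \<in> {1..n}" for T r i
    using that length by (auto simp: SSYT_content_def)
  have content_step: "?c T \<in> SSYT_content lam mu (rotate (Suc r) \<alpha>)"
    if "T \<in> SSYT_content lam mu (rotate r \<alpha>)" for T r
    using crystal_cycle_SSYT_content[OF assms(2) that length] by (simp add: rotate_rotate)
  have stat_step: "(?stat (?c T) + m) mod n = ?stat T mod n"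
    if "T \<in> SSYT_content lam mu (rotate r \<alpha>)" for T r
  proof -
    have "(\<Sum>i=1..n. weight lam mu T i) = (\<Sum>i=1..n. rotate r \<alpha> ! (i - 1))"
      by (rule sum.cong) (simp_all add: content_weight[OF that])
    also have "\<dots> = (\<Sum>i<n. rotate r \<alpha> ! i)"
      by (rule sum.reindex_bij_witness[of _ Suc "\<lambda>i. i - 1"]) auto
    also have "\<dots> = m"
      using sum[of r] length[of r] by (simp add: sum_list_sum_nth atLeast0LessThan)
    finally have "?stat (?c T) + m = ?stat T + n * weight lam mu T 1"
      using sum_shift_weight[OF assms(1), of "weight lam mu T"]
      by (simp add: weight_crystal_cycle)
    then show ?thesis by simp
  qed
  have closed: "?c T \<in> X" if T: "T \<in> X" for T
  proof -
    obtain r where r: "r \<in> {1..n}" "T \<in> SSYT_content lam mu (rotate r \<alpha>)"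
      using T assms(6) by blast
    show ?thesis
    proof (cases "r = n")
      case True
      have "rotate (Suc n) \<alpha> = rotate 1 \<alpha>"
        using assms(4) by (subst (1 2) rotate_conv_mod) (simp add: weak_composition_def mod_Suc)
      then have "?c T \<in> SSYT_content lam mu (rotate 1 \<alpha>)"
        using content_step[OF r(2)] True by simp
      moreover have "1 \<in> {1..n}" using assms(1) by simp
      ultimately show ?thesis unfolding assms(6) by blast
    next
      case False
      then have "Suc r \<in> {1..n}" using r(1) by simp
      then show ?thesis using content_step[OF r(2)] assms(6) by blast
    qed
  qed
  have stat: "(?stat (?c T) + m) mod n = ?stat T mod n" if "T \<in> X" for T
    using that stat_step assms(6) by blast
  have disjoint: "T \<notin> SSYT_content lam mu (rotate s \<alpha>)"
    if rs: "1 \<le> r" "r < s" "s \<le> n" and T: "T \<in> SSYT_content lam mu (rotate r \<alpha>)" for T r s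
  proof
    assume T': "T \<in> SSYT_content lam mu (rotate s \<alpha>)"
    \<comment> \<open>If the contents agree, then \<open>c\<close> returns to the exponent of \<open>T\<close> after only \<open>s - r\<close> steps.\<close>
    have "(?c ^^ k) T \<in> SSYT_content lam mu (rotate (k + r) \<alpha>)" for k
      using T content_step by (induction k) auto
    from this[of "s - r"] have "(?c ^^ (s - r)) T \<in> SSYT_content lam mu (rotate s \<alpha>)"
      using rs by simp
    then have "?stat ((?c ^^ (s - r)) T) = ?stat T"
      using content_weight T' by (intro sum.cong) auto
    moreover have "T \<in> X" using rs T assms(6) by auto
    ultimately have "n dvd s - r"
      by (intro dvd_return_time[of X ?c ?stat, OF closed stat assms(5)]) simp_all
    then show False using rs by (auto dest: dvd_imp_le)
  qed
  show "disjoint_family_on (\<lambda>r. SSYT_content lam mu (rotate r \<alpha>)) {1..n}"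
    unfolding disjoint_family_on_def
  proof (intro ballI impI)
    fix r s assume "r \<in> {1..n}" "s \<in> {1..n}" "r \<noteq> s"
    then show "SSYT_content lam mu (rotate r \<alpha>) \<inter> SSYT_content lam mu (rotate s \<alpha>) = {}"
      using disjoint[of r s] disjoint[of s r] by (cases r s rule: linorder_cases) auto
  qed
  have "SSYT_content lam mu (rotate r \<alpha>) \<subseteq> SSYT lam mu n" for r
    using length by (auto simp: SSYT_content_def)
  then have "finite X"
    unfolding assms(6) by (intro finite_subset[OF _ finite_SSYT[of lam mu n]]) blast
  then show "exhibits_CSP X (cycle_group n) (cycle_action lam mu n X) (\<Sum>T\<in>X. monom 1 (?stat T))"
    by (rule cycle_action_exhibits_CSP[where stat = ?stat and m = m, OF assms(1) _ assms(5) closed stat])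
qed

end
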